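(* Let $(H,\Delta)$ be a Hopf algebra with invariant functionals, $(A,\alpha)$ an $I$-Galois object, and $\psi_A$ a left complete invariant functional on $A$. Then there is a bijection $\mu:I\to I$ such that $\psi_{ij}\neq0$ if and only if $j=\mu(i)$. Moreover, for any invariant functional $\widetilde\psi$ on $A$ there are scalars $c_i\in k$ ($i\in I$) such that $\widetilde\psi_{ij}=\delta_{j,\mu(i)}c_i\psi_{ij}$ for all $i,j\in I$.
   Context: $H$ has invariant functionals: nonzero $\varphi,\psi:H\to k$ with $(\mathrm{id}\otimes\varphi)\Delta(h)=\varphi(h)1$, $(\psi\otimes\mathrm{id})\Delta(h)=\psi(h)1$. An $I$-Galois object is a right $H$-comodule algebra $(A,\alpha)$ (possibly non-unital) with bijective Galois map $A\otimes_{A^\alpha}A\to A\otimes H$, $a\otimes b\mapsto(a\otimes1)\alpha(b)$, and coinvariant algebra $A^\alpha$ identified with $k_I=\bigoplus_{i\in I}k$, minimal idempotents $p_i$. A functional $\chi:A\to k$ is invariant if $(\chi\otimes\mathrm{id})\alpha(x)=\chi(x)1_H$ for all $x$; left complete if $\chi(p_i\,\cdot)\ne0$ for all $i$. For a functional $\chi$, $\chi_{ij}:A\to k$, $a\mapsto\chi(p_iap_j)$; $\delta_{j,\mu(i)}$ is the Kronecker delta. *)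

theory Defs
  imports Complex_Main
begin

definition bilin ::
  "('k::field \<Rightarrow> 'v::ab_group_add \<Rightarrow> 'v) \<Rightarrow> ('k \<Rightarrow> 'w::ab_group_add \<Rightarrow> 'w) \<Rightarrow>
   ('k \<Rightarrow> 'u::ab_group_add \<Rightarrow> 'u) \<Rightarrow> ('v \<Rightarrow> 'w \<Rightarrow> 'u) \<Rightarrow> bool" where
  "bilin s1 s2 s3 f \<longleftrightarrow>
     (\<forall>v. Vector_Spaces.linear s2 s3 (f v)) \<and> (\<forall>w. Vector_Spaces.linear s1 s3 (\<lambda>v. f v w))"

text \<open>(sT, t) is a tensor product of V and W: t is bilinear, its image spans T, and
every bilinear form on V x W factors through a linear functional on T.  Over a field
this characterises V \<otimes> W up to unique isomorphism compatible with t.\<close>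
definition is_tensor_product ::
  "('k::field \<Rightarrow> 'v::ab_group_add \<Rightarrow> 'v) \<Rightarrow> ('k \<Rightarrow> 'w::ab_group_add \<Rightarrow> 'w) \<Rightarrow>
   ('k \<Rightarrow> 't::ab_group_add \<Rightarrow> 't) \<Rightarrow> ('v \<Rightarrow> 'w \<Rightarrow> 't) \<Rightarrow> bool" where
  "is_tensor_product s1 s2 sT t \<longleftrightarrow>
     vector_space s1 \<and> vector_space s2 \<and> vector_space sT \<and> bilin s1 s2 sT t \<and>
     module.span sT (range (case_prod t)) = UNIV \<and>
     (\<forall>\<beta>. bilin s1 s2 ((*)::'k\<Rightarrow>'k\<Rightarrow>'k) \<beta> \<longrightarrow>
        (\<exists>f. Vector_Spaces.linear sT ((*)::'k\<Rightarrow>'k\<Rightarrow>'k) f \<and> (\<forall>v w. f (t v w) = \<beta> v w)))"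

definition tlift ::
  "('k::field \<Rightarrow> 't::ab_group_add \<Rightarrow> 't) \<Rightarrow> ('k \<Rightarrow> 'x::ab_group_add \<Rightarrow> 'x) \<Rightarrow>
   ('v \<Rightarrow> 'w \<Rightarrow> 't) \<Rightarrow> ('v \<Rightarrow> 'w \<Rightarrow> 'x) \<Rightarrow> 't \<Rightarrow> 'x" where
  "tlift sT sX t \<beta> = (THE F. Vector_Spaces.linear sT sX F \<and> (\<forall>v w. F (t v w) = \<beta> v w))"

definition tmult ::
  "('k::field \<Rightarrow> 't::ab_group_add \<Rightarrow> 't) \<Rightarrow> ('v::ring \<Rightarrow> 'w::ring \<Rightarrow> 't) \<Rightarrow> 't \<Rightarrow> 't \<Rightarrow> 't" where
  "tmult sT t x y = tlift sT sT t (\<lambda>a h. tlift sT sT t (\<lambda>b g. t (a * b) (h * g)) y) x"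

text \<open>The map V\<otimes>W \<rightarrow> (V\<otimes>W)\<otimes>X given by (id \<otimes> D) followed by the associativity
isomorphism V\<otimes>(W\<otimes>X) \<cong> (V\<otimes>W)\<otimes>X, where D : W \<rightarrow> W\<otimes>X.\<close>
definition id_tensor_assoc ::
  "('k::field \<Rightarrow> 'vw::ab_group_add \<Rightarrow> 'vw) \<Rightarrow> ('k \<Rightarrow> 'wx::ab_group_add \<Rightarrow> 'wx) \<Rightarrow>
   ('k \<Rightarrow> 'vwx::ab_group_add \<Rightarrow> 'vwx) \<Rightarrow>
   ('v \<Rightarrow> 'w \<Rightarrow> 'vw) \<Rightarrow> ('w \<Rightarrow> 'x \<Rightarrow> 'wx) \<Rightarrow> ('vw \<Rightarrow> 'x \<Rightarrow> 'vwx) \<Rightarrow>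
   ('w \<Rightarrow> 'wx) \<Rightarrow> 'vw \<Rightarrow> 'vwx" where
  "id_tensor_assoc sVW sWX sVWX tVW tWX tVWX D =
     tlift sVW sVWX tVW (\<lambda>v w. tlift sWX sVWX tWX (\<lambda>w' x. tVWX (tVW v w') x) (D w))"

definition is_algebra :: "('k::field \<Rightarrow> 'a::ring \<Rightarrow> 'a) \<Rightarrow> bool" where
  "is_algebra s \<longleftrightarrow> vector_space s \<and>
     (\<forall>c x y. s c (x * y) = s c x * y \<and> s c (x * y) = x * s c y)"

definition hopf_algebra ::
  "('k::field \<Rightarrow> 'h::ring_1 \<Rightarrow> 'h) \<Rightarrow> ('k \<Rightarrow> 'hh::ab_group_add \<Rightarrow> 'hh) \<Rightarrow>
   ('k \<Rightarrow> 'hhh::ab_group_add \<Rightarrow> 'hhh) \<Rightarrow> ('h \<Rightarrow> 'h \<Rightarrow> 'hh) \<Rightarrow> ('hh \<Rightarrow> 'h \<Rightarrow> 'hhh) \<Rightarrow>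
   ('h \<Rightarrow> 'hh) \<Rightarrow> ('h \<Rightarrow> 'k) \<Rightarrow> ('h \<Rightarrow> 'h) \<Rightarrow> bool" where
  "hopf_algebra sH sHH sHHH tHH tHHH \<Delta> \<epsilon> S \<longleftrightarrow>
     is_algebra sH \<and> is_tensor_product sH sH sHH tHH \<and> is_tensor_product sHH sH sHHH tHHH \<and>
     Vector_Spaces.linear sH sHH \<Delta> \<and> Vector_Spaces.linear sH (*) \<epsilon> \<and> Vector_Spaces.linear sH sH S \<and>
     \<comment> \<open>coassociativity: (\<Delta>\<otimes>id)\<Delta> = (id\<otimes>\<Delta>)\<Delta>\<close>
     (\<forall>h. tlift sHH sHHH tHH (\<lambda>a b. tHHH (\<Delta> a) b) (\<Delta> h)
            = id_tensor_assoc sHH sHH sHHH tHH tHH tHHH \<Delta> (\<Delta> h)) \<and>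
     \<comment> \<open>counit: (\<epsilon>\<otimes>id)\<Delta> = id = (id\<otimes>\<epsilon>)\<Delta>\<close>
     (\<forall>h. tlift sHH sH tHH (\<lambda>a b. sH (\<epsilon> a) b) (\<Delta> h) = h) \<and>
     (\<forall>h. tlift sHH sH tHH (\<lambda>a b. sH (\<epsilon> b) a) (\<Delta> h) = h) \<and>
     \<comment> \<open>\<Delta> and \<epsilon> are unital algebra homomorphisms\<close>
     (\<forall>x y. \<Delta> (x * y) = tmult sHH tHH (\<Delta> x) (\<Delta> y)) \<and> \<Delta> 1 = tHH 1 1 \<and>
     (\<forall>x y. \<epsilon> (x * y) = \<epsilon> x * \<epsilon> y) \<and> \<epsilon> 1 = 1 \<and>
     \<comment> \<open>antipode: m(S\<otimes>id)\<Delta> = \<epsilon>(\<cdot>)1 = m(id\<otimes>S)\<Delta>\<close>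
     (\<forall>h. tlift sHH sH tHH (\<lambda>a b. S a * b) (\<Delta> h) = sH (\<epsilon> h) 1) \<and>
     (\<forall>h. tlift sHH sH tHH (\<lambda>a b. a * S b) (\<Delta> h) = sH (\<epsilon> h) 1)"

definition has_invariant_functionals ::
  "('k::field \<Rightarrow> 'h::ring_1 \<Rightarrow> 'h) \<Rightarrow> ('k \<Rightarrow> 'hh::ab_group_add \<Rightarrow> 'hh) \<Rightarrow>
   ('h \<Rightarrow> 'h \<Rightarrow> 'hh) \<Rightarrow> ('h \<Rightarrow> 'hh) \<Rightarrow> bool" where
  "has_invariant_functionals sH sHH tHH \<Delta> \<longleftrightarrow>
     (\<exists>\<phi> \<psi>. Vector_Spaces.linear sH ((*)::'k\<Rightarrow>'k\<Rightarrow>'k) \<phi> \<and> Vector_Spaces.linear sH ((*)::'k\<Rightarrow>'k\<Rightarrow>'k) \<psi> \<and>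
        (\<exists>h. \<phi> h \<noteq> 0) \<and> (\<exists>h. \<psi> h \<noteq> 0) \<and>
        (\<forall>h. tlift sHH sH tHH (\<lambda>a b. sH (\<phi> b) a) (\<Delta> h) = sH (\<phi> h) 1) \<and>
        (\<forall>h. tlift sHH sH tHH (\<lambda>a b. sH (\<psi> a) b) (\<Delta> h) = sH (\<psi> h) 1))"

definition comodule_algebra ::
  "('k::field \<Rightarrow> 'a::ring \<Rightarrow> 'a) \<Rightarrow> ('k \<Rightarrow> 'h::ring_1 \<Rightarrow> 'h) \<Rightarrow> ('k \<Rightarrow> 'hh::ab_group_add \<Rightarrow> 'hh) \<Rightarrow>
   ('k \<Rightarrow> 'ah::ab_group_add \<Rightarrow> 'ah) \<Rightarrow> ('k \<Rightarrow> 'ahh::ab_group_add \<Rightarrow> 'ahh) \<Rightarrow>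
   ('h \<Rightarrow> 'h \<Rightarrow> 'hh) \<Rightarrow> ('a \<Rightarrow> 'h \<Rightarrow> 'ah) \<Rightarrow> ('ah \<Rightarrow> 'h \<Rightarrow> 'ahh) \<Rightarrow>
   ('h \<Rightarrow> 'hh) \<Rightarrow> ('h \<Rightarrow> 'k) \<Rightarrow> ('a \<Rightarrow> 'ah) \<Rightarrow> bool" where
  "comodule_algebra sA sH sHH sAH sAHH tHH tAH tAHH \<Delta> \<epsilon> \<alpha> \<longleftrightarrow>
     is_algebra sA \<and> is_tensor_product sA sH sAH tAH \<and> is_tensor_product sAH sH sAHH tAHH \<and>
     Vector_Spaces.linear sA sAH \<alpha> \<and>
     (\<forall>x y. \<alpha> (x * y) = tmult sAH tAH (\<alpha> x) (\<alpha> y)) \<and>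
     \<comment> \<open>(\<alpha>\<otimes>id)\<alpha> = (id\<otimes>\<Delta>)\<alpha>\<close>
     (\<forall>x. tlift sAH sAHH tAH (\<lambda>a h. tAHH (\<alpha> a) h) (\<alpha> x)
            = id_tensor_assoc sAH sHH sAHH tAH tHH tAHH \<Delta> (\<alpha> x)) \<and>
     \<comment> \<open>(id\<otimes>\<epsilon>)\<alpha> = id\<close>
     (\<forall>x. tlift sAH sA tAH (\<lambda>a h. sA (\<epsilon> h) a) (\<alpha> x) = x)"

definition coinvariants :: "('a \<Rightarrow> 'h::one \<Rightarrow> 'ah) \<Rightarrow> ('a \<Rightarrow> 'ah) \<Rightarrow> 'a set" where
  "coinvariants tAH \<alpha> = {a. \<alpha> a = tAH a 1}"

text \<open>I-Galois object: (A,\<alpha>) comodule algebra; A^\<alpha> is identified with k_I, its minimal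
idempotents being p i (i \<in> I): the p i are nonzero, pairwise orthogonal idempotents
spanning A^\<alpha>; and the Galois map A \<otimes>_{A^\<alpha>} A \<rightarrow> A\<otimes>H is bijective.  A\<otimes>A is realised by
tAA; the balanced tensor product A \<otimes>_{A^\<alpha>} A is the quotient of A\<otimes>A by the span of the
elements ap\<otimes>b - a\<otimes>pb (p \<in> A^\<alpha>), so bijectivity means: the induced map on A\<otimes>A is surjective
and its kernel is exactly that span.\<close>
definition galois_object ::
  "('k::field \<Rightarrow> 'a::ring \<Rightarrow> 'a) \<Rightarrow> ('k \<Rightarrow> 'h::ring_1 \<Rightarrow> 'h) \<Rightarrow> ('k \<Rightarrow> 'hh::ab_group_add \<Rightarrow> 'hh) \<Rightarrow>
   ('k \<Rightarrow> 'ah::ab_group_add \<Rightarrow> 'ah) \<Rightarrow> ('k \<Rightarrow> 'ahh::ab_group_add \<Rightarrow> 'ahh) \<Rightarrow>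
   ('k \<Rightarrow> 'aa::ab_group_add \<Rightarrow> 'aa) \<Rightarrow>
   ('h \<Rightarrow> 'h \<Rightarrow> 'hh) \<Rightarrow> ('a \<Rightarrow> 'h \<Rightarrow> 'ah) \<Rightarrow> ('ah \<Rightarrow> 'h \<Rightarrow> 'ahh) \<Rightarrow> ('a \<Rightarrow> 'a \<Rightarrow> 'aa) \<Rightarrow>
   ('h \<Rightarrow> 'hh) \<Rightarrow> ('h \<Rightarrow> 'k) \<Rightarrow> ('a \<Rightarrow> 'ah) \<Rightarrow> 'i set \<Rightarrow> ('i \<Rightarrow> 'a) \<Rightarrow> bool" where
  "galois_object sA sH sHH sAH sAHH sAA tHH tAH tAHH tAA \<Delta> \<epsilon> \<alpha> I p \<longleftrightarrow>
     comodule_algebra sA sH sHH sAH sAHH tHH tAH tAHH \<Delta> \<epsilon> \<alpha> \<and>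
     is_tensor_product sA sA sAA tAA \<and>
     (\<forall>i\<in>I. p i \<noteq> 0 \<and> p i * p i = p i) \<and>
     (\<forall>i\<in>I. \<forall>j\<in>I. i \<noteq> j \<longrightarrow> p i * p j = 0) \<and>
     coinvariants tAH \<alpha> = module.span sA (p ` I) \<and>
     (let G = tlift sAA sAH tAA (\<lambda>a b. tmult sAH tAH (tAH a 1) (\<alpha> b)) in
        surj G \<and>
        {z. G z = 0} = module.span sAA
           {tAA (a * q) b - tAA a (q * b) | a b q. q \<in> coinvariants tAH \<alpha>})"

definition invariant_functional ::
  "('k::field \<Rightarrow> 'a::ab_group_add \<Rightarrow> 'a) \<Rightarrow> ('k \<Rightarrow> 'h::{ab_group_add,one} \<Rightarrow> 'h) \<Rightarrow>
   ('k \<Rightarrow> 'ah::ab_group_add \<Rightarrow> 'ah) \<Rightarrow> ('a \<Rightarrow> 'h \<Rightarrow> 'ah) \<Rightarrow> ('a \<Rightarrow> 'ah) \<Rightarrow> ('a \<Rightarrow> 'k) \<Rightarrow> bool" where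
  "invariant_functional sA sH sAH tAH \<alpha> \<chi> \<longleftrightarrow>
     Vector_Spaces.linear sA ((*)::'k\<Rightarrow>'k\<Rightarrow>'k) \<chi> \<and>
     (\<forall>x. tlift sAH sH tAH (\<lambda>a h. sH (\<chi> a) h) (\<alpha> x) = sH (\<chi> x) 1)"

definition left_complete :: "'i set \<Rightarrow> ('i \<Rightarrow> 'a::times) \<Rightarrow> ('a \<Rightarrow> 'k::zero) \<Rightarrow> bool" where
  "left_complete I p \<chi> \<longleftrightarrow> (\<forall>i\<in>I. \<exists>a. \<chi> (p i * a) \<noteq> 0)"

definition corner :: "('i \<Rightarrow> 'a::times) \<Rightarrow> ('a \<Rightarrow> 'k) \<Rightarrow> 'i \<Rightarrow> 'i \<Rightarrow> 'a \<Rightarrow> 'k" where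
  "corner p \<chi> i j = (\<lambda>a. \<chi> (p i * a * p j))"

end

theory Submission
  imports Defs
begin

text \<open>Right integrals on \<open>H\<close> are unique up to scalars, so \<open>h\<^sub>1 \<phi>(S h\<^sub>2) = \<phi>(S h) g\<close> for a left integral \<open>\<phi>\<close> and a
  grouplike \<open>g\<close>. Hence \<open>R(b) = b\<^sub>0 \<phi>(S b\<^sub>1)\<close> lies in \<open>A\<^sub>g = {a. \<alpha>(a) = a \<otimes> g}\<close>, while \<open>E(a) = a\<^sub>0 \<phi>(a\<^sub>1)\<close> is
  coinvariant, and every invariant functional satisfies \<open>\<psi>(E(a) b) = \<psi>(a R(b))\<close>. For any grouplike \<open>x\<close>,
  applying \<open>\<phi>(x\<inverse> \<cdot>)\<close> to the second leg of the surjective Galois map gives \<open>A = A A\<^sub>x\<close>. Taking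
  \<open>x = g, g\<inverse>, 1\<close>, this makes \<open>A\<^sub>g\<close> an invertible bimodule over \<open>k\<^sub>I\<close>, that is, the bimodule of a permutation \<open>\<mu>\<close>
  of \<open>I\<close>: \<open>p\<^sub>i A\<^sub>g\<close> is a line, contained in \<open>A p\<^sub>\<mu>\<^sub>(\<^sub>i\<^sub>)\<close>. Choosing \<open>a\<close> with \<open>E(a) p\<^sub>i = p\<^sub>i\<close>,
  \<open>\<psi>(p\<^sub>i b) = \<psi>(a p\<^sub>i R(b))\<close> shows that \<open>\<psi>(p\<^sub>i \<cdot>)\<close> is determined up to a scalar and supported on column \<open>\<mu>(i)\<close>.\<close>

section \<open>Tensor products and Sweedler sums\<close>

lemma linear_sum_eq:
  "Vector_Spaces.linear s1 s2 f \<Longrightarrow> f (\<Sum>x\<in>A. g x) = (\<Sum>x\<in>A. f (g x))"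
  by (simp add: linear_iff_module_hom module_hom.sum)

lemma linear_zero_eq: "Vector_Spaces.linear s1 s2 f \<Longrightarrow> f 0 = 0"
  by (simp add: linear_iff_module_hom module_hom.zero)

lemma vector_space_times: "vector_space ((*) :: 'k::field \<Rightarrow> 'k \<Rightarrow> 'k)"
  by unfold_locales (simp_all add: algebra_simps)

lemma algebra_scale_mult:
  assumes "is_algebra s"
  shows "s c x * y = s c (x * y)" "x * s c y = s c (x * y)"
  using assms unfolding is_algebra_def by metis+

lemma bilin_iff:
  "bilin s1 s2 s3 f \<longleftrightarrow> vector_space s1 \<and> vector_space s2 \<and> vector_space s3 \<and>
     (\<forall>x y w. f (x + y) w = f x w + f y w) \<and> (\<forall>c x w. f (s1 c x) w = s3 c (f x w)) \<and>
     (\<forall>x v w. f x (v + w) = f x v + f x w) \<and> (\<forall>c x w. f x (s2 c w) = s3 c (f x w))"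
  unfolding bilin_def Vector_Spaces.linear_iff by auto

section \<open>Separation by functionals and the universal property of tensor products\<close>

lemma functional_separates:
  fixes s :: "'k::field \<Rightarrow> 'v::ab_group_add \<Rightarrow> 'v"
  assumes "vector_space s" and "v \<noteq> 0"
  obtains f where "Vector_Spaces.linear s ((*)::'k \<Rightarrow> 'k \<Rightarrow> 'k) f" "f v = 1"
proof -
  interpret vector_space_pair s "(*) :: 'k \<Rightarrow> 'k \<Rightarrow> 'k"
    using assms vector_space_times by (simp add: vector_space_pair_def)
  have "vs1.independent {v}" using assms by simp
  from linear_independent_extend[OF this, of "\<lambda>_. 1"] that show thesis by auto
qed

lemma functional_eqI:
  fixes s :: "'k::field \<Rightarrow> 'v::ab_group_add \<Rightarrow> 'v"
  assumes "vector_space s"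
    and "\<And>f. Vector_Spaces.linear s ((*)::'k \<Rightarrow> 'k \<Rightarrow> 'k) f \<Longrightarrow> f v = f w"
  shows "v = w"
proof (rule ccontr)
  assume "v \<noteq> w"
  then obtain f where f: "Vector_Spaces.linear s ((*)::'k \<Rightarrow> 'k \<Rightarrow> 'k) f" "f (v - w) = 1"
    using functional_separates[OF assms(1), of "v - w"] by auto
  have "f (v - w) = f v - f w"
    using f(1) by (simp add: linear_iff_module_hom module_hom.diff)
  with f assms(2)[OF f(1)] show False by simp
qed

text \<open>\<open>is_tensor_product\<close> only promises lifts of scalar-valued forms. A maximal
  independent set \<open>C\<close> of pure tensors is a basis, so \<open>F\<close> may be prescribed
  on \<open>C\<close>. Its values on the other pure tensors are tested against each functional
  \<open>f\<close>: the form \<open>f\<close> composed with \<open>\<beta>\<close> has a lift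
  \<open>L\<close>, which agrees with \<open>f\<close> composed with \<open>F\<close> on
  \<open>C\<close> and hence everywhere.\<close>

lemma tensor_lift_exists:
  fixes s1 :: "'k::field \<Rightarrow> 'v::ab_group_add \<Rightarrow> 'v"
    and sX :: "'k \<Rightarrow> 'x::ab_group_add \<Rightarrow> 'x"
  assumes T: "is_tensor_product s1 s2 sT t" and b: "bilin s1 s2 sX \<beta>"
  shows "\<exists>F. Vector_Spaces.linear sT sX F \<and> (\<forall>v w. F (t v w) = \<beta> v w)"
proof -
  have vs: "vector_space sT" "vector_space sX"
    using T b by (auto simp: is_tensor_product_def bilin_iff)
  interpret vector_space_pair sT sX using vs by (simp add: vector_space_pair_def)
  obtain C where C: "C \<subseteq> range (case_prod t)" "vs1.independent C" "range (case_prod t) \<subseteq> vs1.span C"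
    using vs1.maximal_independent_subset[of "range (case_prod t)"] by auto
  have "vs1.span (range (case_prod t)) \<subseteq> vs1.span C"
    using C(3) by (rule vs1.span_minimal) (rule vs1.subspace_span)
  then have spC: "vs1.span C = UNIV" using T unfolding is_tensor_product_def by auto
  \<comment> \<open>\<open>SOME\<close> picks one way of writing the basis element as a pure tensor;
    the lift \<open>L\<close> below shows that the choice is harmless.\<close>
  obtain F where F: "Vector_Spaces.linear sT sX F"
    "\<And>c. c \<in> C \<Longrightarrow> F c = case_prod \<beta> (SOME vw. c = case_prod t vw)"
    using linear_independent_extend[OF C(2), of "\<lambda>c. case_prod \<beta> (SOME vw. c = case_prod t vw)"] by auto
  have "F (t v w) = \<beta> v w" for v w
  proof (rule functional_eqI[OF vs(2)])
    fix f assume f: "Vector_Spaces.linear sX ((*)::'k \<Rightarrow> 'k \<Rightarrow> 'k) f"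
    have "bilin s1 s2 (*) (\<lambda>v w. f (\<beta> v w))"
      using b f by (auto simp: bilin_iff Vector_Spaces.linear_iff)
    then obtain L where L: "Vector_Spaces.linear sT ((*)::'k \<Rightarrow> 'k \<Rightarrow> 'k) L"
      "\<And>v w. L (t v w) = f (\<beta> v w)"
      using T unfolding is_tensor_product_def by blast
    have fF: "Vector_Spaces.linear sT ((*)::'k \<Rightarrow> 'k \<Rightarrow> 'k) (\<lambda>u. f (F u))"
      using F(1) f by (auto simp: Vector_Spaces.linear_iff)
    interpret k: vector_space_pair sT "(*) :: 'k \<Rightarrow> 'k \<Rightarrow> 'k"
      using vs vector_space_times by (simp add: vector_space_pair_def)
    have "L u = f (F u)" for u
    proof (rule k.linear_eq_on[OF L(1) fF])
      show "u \<in> vs1.span C" by (simp add: spC)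
    next
      fix c assume c: "c \<in> C"
      then obtain vw where "c = case_prod t vw" using C(1) by auto
      then have "c = case_prod t (SOME vw. c = case_prod t vw)" by (rule someI)
      then show "L c = f (F c)" unfolding F(2)[OF c] using L(2) by (metis case_prod_beta)
    qed
    then show "f (F (t v w)) = f (\<beta> v w)" using L(2) by metis
  qed
  with F(1) show ?thesis by blast
qed

lemma linear_eq_on_tensors:
  assumes T: "is_tensor_product s1 s2 sT t"
    and F: "Vector_Spaces.linear sT sX F" and G: "Vector_Spaces.linear sT sX G"
    and eq: "\<And>v w. F (t v w) = G (t v w)"
  shows "F u = G u"
proof -
  have vs: "vector_space sT" "vector_space sX"
    using T F by (auto simp: is_tensor_product_def Vector_Spaces.linear_iff)
  interpret vector_space_pair sT sX using vs by (simp add: vector_space_pair_def)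
  show ?thesis
  proof (rule linear_eq_on[OF F G])
    show "u \<in> vs1.span (range (case_prod t))" using T by (simp add: is_tensor_product_def)
  qed (use eq in auto)
qed

lemma tlift:
  assumes T: "is_tensor_product s1 s2 sT t" and b: "bilin s1 s2 sX \<beta>"
  shows linear_tlift: "Vector_Spaces.linear sT sX (tlift sT sX t \<beta>)"
    and tlift_tensor: "tlift sT sX t \<beta> (t v w) = \<beta> v w"
proof -
  have "\<exists>!F. Vector_Spaces.linear sT sX F \<and> (\<forall>v w. F (t v w) = \<beta> v w)"
    using tensor_lift_exists[OF T b] linear_eq_on_tensors[OF T, of sX]
    by (metis (no_types, lifting) ext)
  from theI'[OF this] show "Vector_Spaces.linear sT sX (tlift sT sX t \<beta>)"
    "tlift sT sX t \<beta> (t v w) = \<beta> v w" unfolding tlift_def by auto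
qed

text \<open>Expand the second factors in a basis and collect coefficients. The independence of the
  second legs is recorded for \<open>right_integral_faithful\<close>, where coefficients are read
  off from a vanishing sum.\<close>

lemma tensor_representation_exists:
  fixes s2 :: "'k::field \<Rightarrow> 'w::ab_group_add \<Rightarrow> 'w"
  assumes T: "is_tensor_product s1 s2 sT t"
  shows "\<exists>r. finite (fst r) \<and> \<not> module.dependent s2 (fst r) \<and> u = (\<Sum>c\<in>fst r. t (snd r c) c)"
proof -
  have vs: "vector_space s1" "vector_space s2" "vector_space sT" and b: "bilin s1 s2 sT t"
    using T by (auto simp: is_tensor_product_def)
  interpret V: vector_space s1 by fact
  interpret W: vector_space s2 by fact
  interpret T: vector_space sT by fact
  define B where "B = W.extend_basis {}"
  have B: "W.independent B" "W.span B = UNIV"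
    unfolding B_def by (auto simp: W.independent_extend_basis W.independent_empty)
  define P where "P u \<longleftrightarrow> (\<exists>C m. finite C \<and> C \<subseteq> B \<and> u = (\<Sum>c\<in>C. t (m c) c))" for u
  have t0: "t 0 w = 0" for w
    using b unfolding bilin_iff by (metis add_cancel_right_left)
  have tsum: "t x (\<Sum>c\<in>C. f c) = (\<Sum>c\<in>C. t x (f c))" for x C and f :: "'w \<Rightarrow> 'w"
    using b unfolding bilin_def by (blast intro: linear_sum_eq)
  \<comment> \<open>Padding with zero coefficients brings two expansions to a common
    support.\<close>
  have extend: "\<exists>m'. (\<Sum>c\<in>C. t (m c) c) = (\<Sum>c\<in>D. t (m' c) c)" if "finite D" "C \<subseteq> D" for m C D
    using that by (intro exI[of _ "\<lambda>c. if c \<in> C then m c else 0"] sum.mono_neutral_cong_left) (auto simp: t0)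
  have "P u" if "u \<in> T.span (range (case_prod t))" for u
    using that
  proof (induction rule: T.span_induct_alt)
    case base
    show ?case unfolding P_def by (rule exI[of _ "{}"]) auto
  next
    case (step a x y)
    obtain v w where x: "x = t v w" using step by auto
    obtain C m where C: "finite C" "C \<subseteq> B" "y = (\<Sum>c\<in>C. t (m c) c)"
      using step unfolding P_def by auto
    define D where "D = {c. W.representation B w c \<noteq> 0}"
    have D: "finite D" "D \<subseteq> B" "w = (\<Sum>c\<in>D. s2 (W.representation B w c) c)"
      unfolding D_def
      using W.finite_representation[of B w] W.representation_ne_zero[of B w]
        W.sum_nonzero_representation_eq[OF B(1), of w] B(2) by auto
    have "sT a x = (\<Sum>c\<in>D. t (s1 (a * W.representation B w c) v) c)"
      unfolding x by (subst D(3), subst tsum) (use b in \<open>simp add: bilin_iff T.scale_sum_right\<close>)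
    also obtain m1 where "(\<Sum>c\<in>D. t (s1 (a * W.representation B w c) v) c) = (\<Sum>c\<in>C\<union>D. t (m1 c) c)"
      using extend[of "C \<union> D" D "\<lambda>c. s1 (a * W.representation B w c) v"] C D by auto
    finally have x': "sT a x = (\<Sum>c\<in>C\<union>D. t (m1 c) c)" .
    obtain m2 where y': "y = (\<Sum>c\<in>C\<union>D. t (m2 c) c)"
      using extend[of "C \<union> D" C m] C D by auto
    have "sT a x + y = (\<Sum>c\<in>C\<union>D. t (m1 c + m2 c) c)"
      using b unfolding x' y' bilin_iff by (simp add: sum.distrib)
    then show ?case unfolding P_def
      using C D by (intro exI[of _ "C \<union> D"] exI[of _ "\<lambda>c. m1 c + m2 c"]) auto
  qed
  then have "P u" using T by (simp add: is_tensor_product_def)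
  then obtain C m where C: "finite C" "C \<subseteq> B" "u = (\<Sum>c\<in>C. t (m c) c)" unfolding P_def by auto
  with B(1) have "W.independent C" using W.independent_mono by blast
  with C show ?thesis by (intro exI[of _ "(C, m)"]) auto
qed

definition tensor_rep ::
  "('k::field \<Rightarrow> 'w::ab_group_add \<Rightarrow> 'w) \<Rightarrow> ('v \<Rightarrow> 'w \<Rightarrow> 't::ab_group_add) \<Rightarrow> 't \<Rightarrow> 'w set \<times> ('w \<Rightarrow> 'v)" where
  "tensor_rep s2 t u =
     (SOME r. finite (fst r) \<and> \<not> module.dependent s2 (fst r) \<and> u = (\<Sum>c\<in>fst r. t (snd r c) c))"

text \<open>Sweedler notation: for \<open>u = \<Sum>\<^sub>c v\<^sub>c \<otimes> c\<close>, \<open>sweedler s2 t u \<beta>\<close> is \<open>\<Sum>\<^sub>c \<beta> v\<^sub>c c\<close>. Fixing one expansion of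
  each tensor makes this a plain finite sum for every \<open>\<beta>\<close>, so that sums over different tensors can be
  interchanged without side conditions; it only depends on \<open>u\<close> when \<open>\<beta>\<close> is bilinear.\<close>
definition sweedler ::
  "('k::field \<Rightarrow> 'w::ab_group_add \<Rightarrow> 'w) \<Rightarrow> ('v \<Rightarrow> 'w \<Rightarrow> 't::ab_group_add) \<Rightarrow> 't \<Rightarrow>
   ('v \<Rightarrow> 'w \<Rightarrow> 'x::ab_group_add) \<Rightarrow> 'x" where
  "sweedler s2 t u \<beta> = (\<Sum>c\<in>fst (tensor_rep s2 t u). \<beta> (snd (tensor_rep s2 t u) c) c)"

lemma tensor_rep:
  assumes "is_tensor_product s1 s2 sT t"
  shows "finite (fst (tensor_rep s2 t u))" "\<not> module.dependent s2 (fst (tensor_rep s2 t u))"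
    and "u = (\<Sum>c\<in>fst (tensor_rep s2 t u). t (snd (tensor_rep s2 t u) c) c)"
  using someI_ex[OF tensor_representation_exists[OF assms, of u]] unfolding tensor_rep_def by auto

lemma sweedler_swap:
  "sweedler s t u (\<lambda>a b. sweedler s' t' u' (\<lambda>c d. \<beta> a b c d)) =
   sweedler s' t' u' (\<lambda>c d. sweedler s t u (\<lambda>a b. \<beta> a b c d))"
  unfolding sweedler_def by (rule sum.swap)

lemma sweedler_add: "sweedler s t u (\<lambda>a b. \<beta> a b + \<gamma> a b) = sweedler s t u \<beta> + sweedler s t u \<gamma>"
  unfolding sweedler_def by (rule sum.distrib)

lemma sweedler_scale:
  "vector_space sX \<Longrightarrow> sweedler s t u (\<lambda>a b. sX c (\<beta> a b)) = sX c (sweedler s t u \<beta>)"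
  unfolding sweedler_def by (simp add: module.scale_sum_right module_iff_vector_space)

lemma linear_sweedler:
  "Vector_Spaces.linear sX sY f \<Longrightarrow> f (sweedler s t u \<beta>) = sweedler s t u (\<lambda>a b. f (\<beta> a b))"
  unfolding sweedler_def by (rule linear_sum_eq)

text \<open>Translates the \<open>THE\<close>-defined lifts of the definitions into finite sums: the
  lift is linear, so it may be evaluated on the chosen expansion of \<open>u\<close>.\<close>

lemma tlift_eq_sweedler:
  assumes T: "is_tensor_product s1 s2 sT t" and b: "bilin s1 s2 sX \<beta>"
  shows "tlift sT sX t \<beta> u = sweedler s2 t u \<beta>"
proof -
  have "tlift sT sX t \<beta> u = tlift sT sX t \<beta> (\<Sum>c\<in>fst (tensor_rep s2 t u). t (snd (tensor_rep s2 t u) c) c)"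
    using tensor_rep(3)[OF T, of u] by simp
  also have "\<dots> = sweedler s2 t u \<beta>"
    unfolding sweedler_def by (subst linear_sum_eq[OF linear_tlift[OF T b]]) (simp add: tlift_tensor[OF T b])
  finally show ?thesis .
qed

text \<open>The chosen expansions need not depend linearly on \<open>u\<close>, but for bilinear
  \<open>\<beta>\<close> the sum equals the lift, which is linear.\<close>

lemma linear_sweedler_arg:
  assumes T: "is_tensor_product s1 s2 sT t" and b: "bilin s1 s2 sX \<beta>"
  shows "Vector_Spaces.linear sT sX (\<lambda>u. sweedler s2 t u \<beta>)"
proof -
  have "tlift sT sX t \<beta> = (\<lambda>u. sweedler s2 t u \<beta>)"
    using tlift_eq_sweedler[OF T b] by blast
  with linear_tlift[OF T b] show ?thesis by simp
qed

lemma sweedler_tensor: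
  assumes T: "is_tensor_product s1 s2 sT t" and b: "bilin s1 s2 sX \<beta>"
  shows "sweedler s2 t (t v w) \<beta> = \<beta> v w"
  using tlift_tensor[OF T b] by (simp add: tlift_eq_sweedler[OF T b])

lemma sweedler_self:
  assumes T: "is_tensor_product s1 s2 sT t"
  shows "sweedler s2 t u t = u"
  unfolding sweedler_def using tensor_rep(3)[OF T, of u] by simp

lemma tmult_eq_sweedler:
  assumes T: "is_tensor_product s1 s2 sT t" and A: "is_algebra s1" "is_algebra s2"
  shows "tmult sT t x y = sweedler s2 t x (\<lambda>a h. sweedler s2 t y (\<lambda>b g. t (a * b) (h * g)))"
proof -
  have vs: "vector_space s1" "vector_space s2" "vector_space sT" and b: "bilin s1 s2 sT t"
    using T by (auto simp: is_tensor_product_def)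
  note simps = distrib_left distrib_right sweedler_add sweedler_scale[OF vs(3)]
    algebra_scale_mult[OF A(1)] algebra_scale_mult[OF A(2)]
  have 1: "bilin s1 s2 sT (\<lambda>b g. t (a * b) (h * g))" for a h
    using b unfolding bilin_iff by (simp add: simps)
  have 2: "bilin s1 s2 sT (\<lambda>a h. sweedler s2 t y (\<lambda>b g. t (a * b) (h * g)))"
    using b unfolding bilin_iff by (simp add: simps)
  show ?thesis
    unfolding tmult_def by (simp add: tlift_eq_sweedler[OF T 1] tlift_eq_sweedler[OF T 2])
qed

section \<open>Hopf algebras and comodule algebras\<close>

definition trilin ::
  "('k::field \<Rightarrow> 'u::ab_group_add \<Rightarrow> 'u) \<Rightarrow> ('k \<Rightarrow> 'v::ab_group_add \<Rightarrow> 'v) \<Rightarrow>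
   ('k \<Rightarrow> 'w::ab_group_add \<Rightarrow> 'w) \<Rightarrow> ('k \<Rightarrow> 'x::ab_group_add \<Rightarrow> 'x) \<Rightarrow> ('u \<Rightarrow> 'v \<Rightarrow> 'w \<Rightarrow> 'x) \<Rightarrow> bool" where
  "trilin s1 s2 s3 sX \<gamma> \<longleftrightarrow>
     (\<forall>a. bilin s2 s3 sX (\<gamma> a)) \<and> (\<forall>b. bilin s1 s3 sX (\<lambda>a c. \<gamma> a b c)) \<and>
     (\<forall>c. bilin s1 s2 sX (\<lambda>a b. \<gamma> a b c))"

locale hopf =
  fixes sH :: "'k::field \<Rightarrow> 'h::ring_1 \<Rightarrow> 'h"
    and sHH :: "'k \<Rightarrow> 'hh::ab_group_add \<Rightarrow> 'hh"
    and sHHH :: "'k \<Rightarrow> 'hhh::ab_group_add \<Rightarrow> 'hhh"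
    and tHH :: "'h \<Rightarrow> 'h \<Rightarrow> 'hh" and tHHH :: "'hh \<Rightarrow> 'h \<Rightarrow> 'hhh"
    and \<Delta> :: "'h \<Rightarrow> 'hh" and \<epsilon> :: "'h \<Rightarrow> 'k" and S :: "'h \<Rightarrow> 'h"
  assumes hopf: "hopf_algebra sH sHH sHHH tHH tHHH \<Delta> \<epsilon> S"
begin

abbreviation functional :: "('h \<Rightarrow> 'k) \<Rightarrow> bool" where
  "functional \<equiv> Vector_Spaces.linear sH ((*)::'k \<Rightarrow> 'k \<Rightarrow> 'k)"

abbreviation SH :: "'h \<Rightarrow> ('h \<Rightarrow> 'h \<Rightarrow> 'x::ab_group_add) \<Rightarrow> 'x" where
  "SH h \<beta> \<equiv> sweedler sH tHH (\<Delta> h) \<beta>"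

lemma algebra_H: "is_algebra sH"
  and tensor_HH: "is_tensor_product sH sH sHH tHH"
  and linear_\<Delta>: "Vector_Spaces.linear sH sHH \<Delta>"
  and linear_\<epsilon>: "functional \<epsilon>"
  and linear_S: "Vector_Spaces.linear sH sH S"
  using hopf unfolding hopf_algebra_def by auto

lemma vs_H: "vector_space sH" and vs_HH: "vector_space sHH" and bilin_HH: "bilin sH sH sHH tHH"
  using tensor_HH by (auto simp: is_tensor_product_def)

lemmas H_simps = algebra_scale_mult[OF algebra_H] distrib_left distrib_right
  vector_space.vector_space_assms[OF vs_H]
  linear_\<epsilon>[unfolded Vector_Spaces.linear_iff, THEN conjunct2, THEN conjunct2, THEN conjunct1, rule_format]
  linear_\<epsilon>[unfolded Vector_Spaces.linear_iff, THEN conjunct2, THEN conjunct2, THEN conjunct2, rule_format]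
  linear_S[unfolded Vector_Spaces.linear_iff, THEN conjunct2, THEN conjunct2, THEN conjunct1, rule_format]
  linear_S[unfolded Vector_Spaces.linear_iff, THEN conjunct2, THEN conjunct2, THEN conjunct2, rule_format]

lemma bilin_HI:
  assumes "vector_space sX"
    and "\<And>x y w. f (x + y) w = f x w + f y w" "\<And>c x w. f (sH c x) w = sX c (f x w)"
    and "\<And>x v w. f x (v + w) = f x v + f x w" "\<And>c x w. f x (sH c w) = sX c (f x w)"
  shows "bilin sH sH sX f"
  using assms vs_H by (simp add: bilin_iff)

lemma counit_left: "SH h (\<lambda>a b. sH (\<epsilon> a) b) = h"
  and counit_right: "SH h (\<lambda>a b. sH (\<epsilon> b) a) = h"
  and antipode_left: "SH h (\<lambda>a b. S a * b) = sH (\<epsilon> h) 1"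
  and antipode_right: "SH h (\<lambda>a b. a * S b) = sH (\<epsilon> h) 1"
proof -
  have "bilin sH sH sH (\<lambda>a b. sH (\<epsilon> a) b)" "bilin sH sH sH (\<lambda>a b. sH (\<epsilon> b) a)"
    "bilin sH sH sH (\<lambda>a b. S a * b)" "bilin sH sH sH (\<lambda>a b. a * S b)"
    by (rule bilin_HI[OF vs_H]; simp add: H_simps mult.commute)+
  note this[THEN tlift_eq_sweedler[OF tensor_HH]]
  then show "SH h (\<lambda>a b. sH (\<epsilon> a) b) = h" "SH h (\<lambda>a b. sH (\<epsilon> b) a) = h"
    "SH h (\<lambda>a b. S a * b) = sH (\<epsilon> h) 1" "SH h (\<lambda>a b. a * S b) = sH (\<epsilon> h) 1"
    using hopf unfolding hopf_algebra_def by metis+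
qed

lemma SH_one: "bilin sH sH sX \<beta> \<Longrightarrow> SH 1 \<beta> = \<beta> 1 1"
  using hopf sweedler_tensor[OF tensor_HH] unfolding hopf_algebra_def by simp

lemma counit_mult: "\<epsilon> (x * y) = \<epsilon> x * \<epsilon> y" and counit_one: "\<epsilon> 1 = 1"
  using hopf unfolding hopf_algebra_def by auto

end

section \<open>Comodule algebras and invariant functionals\<close>

locale hopf_comodule = hopf sH sHH sHHH tHH tHHH \<Delta> \<epsilon> S
  for sH :: "'k::field \<Rightarrow> 'h::ring_1 \<Rightarrow> 'h"
    and sHH :: "'k \<Rightarrow> 'hh::ab_group_add \<Rightarrow> 'hh"
    and sHHH :: "'k \<Rightarrow> 'hhh::ab_group_add \<Rightarrow> 'hhh"
    and tHH :: "'h \<Rightarrow> 'h \<Rightarrow> 'hh" and tHHH :: "'hh \<Rightarrow> 'h \<Rightarrow> 'hhh"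
    and \<Delta> :: "'h \<Rightarrow> 'hh" and \<epsilon> :: "'h \<Rightarrow> 'k" and S :: "'h \<Rightarrow> 'h" +
  fixes sA :: "'k \<Rightarrow> 'a::ring \<Rightarrow> 'a"
    and sAH :: "'k \<Rightarrow> 'ah::ab_group_add \<Rightarrow> 'ah"
    and sAHH :: "'k \<Rightarrow> 'ahh::ab_group_add \<Rightarrow> 'ahh"
    and tAH :: "'a \<Rightarrow> 'h \<Rightarrow> 'ah" and tAHH :: "'ah \<Rightarrow> 'h \<Rightarrow> 'ahh"
    and \<alpha> :: "'a \<Rightarrow> 'ah"
  assumes comod: "comodule_algebra sA sH sHH sAH sAHH tHH tAH tAHH \<Delta> \<epsilon> \<alpha>"
begin

abbreviation SA :: "'a \<Rightarrow> ('a \<Rightarrow> 'h \<Rightarrow> 'x::ab_group_add) \<Rightarrow> 'x" where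
  "SA a \<beta> \<equiv> sweedler sH tAH (\<alpha> a) \<beta>"

lemma algebra_A: "is_algebra sA"
  and tensor_AH: "is_tensor_product sA sH sAH tAH"
  and tensor_AHH: "is_tensor_product sAH sH sAHH tAHH"
  and linear_\<alpha>: "Vector_Spaces.linear sA sAH \<alpha>"
  using comod unfolding comodule_algebra_def by auto

lemma vs_A: "vector_space sA" and vs_AH: "vector_space sAH" and vs_AHH: "vector_space sAHH"
  and bilin_AH: "bilin sA sH sAH tAH" and bilin_AHH: "bilin sAH sH sAHH tAHH"
  using tensor_AH tensor_AHH by (auto simp: is_tensor_product_def)

lemma bilin_AI:
  assumes "vector_space sX"
    and "\<And>x y w. f (x + y) w = f x w + f y w" "\<And>c x w. f (sA c x) w = sX c (f x w)"
    and "\<And>x v w. f x (v + w) = f x v + f x w" "\<And>c x w. f x (sH c w) = sX c (f x w)"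
  shows "bilin sA sH sX f"
  using assms vs_H vs_A by (simp add: bilin_iff)

lemma trilin_AI:
  assumes "vector_space sX"
    and "\<And>x y v w. f (x + y) v w = f x v w + f y v w" "\<And>c x v w. f (sA c x) v w = sX c (f x v w)"
    and "\<And>x u v w. f x (u + v) w = f x u w + f x v w" "\<And>c x v w. f x (sH c v) w = sX c (f x v w)"
    and "\<And>x u v w. f x u (v + w) = f x u v + f x u w" "\<And>c x v w. f x v (sH c w) = sX c (f x v w)"
  shows "trilin sA sH sH sX f"
  using assms vs_H vs_A by (simp add: trilin_def bilin_iff)

lemma linear_SA: "bilin sA sH sX \<beta> \<Longrightarrow> Vector_Spaces.linear sA sX (\<lambda>a. SA a \<beta>)"
  using linear_sweedler_arg[OF tensor_AH, of sX \<beta>] linear_\<alpha> by (simp add: Vector_Spaces.linear_iff)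

text \<open>The form \<open>\<gamma>\<close> induces a linear map \<open>\<Gamma>\<close> on the
  triple tensor product; the two sums are the values of \<open>\<Gamma>\<close> at the two sides of
  the coassociativity axiom of the coaction.\<close>

lemma coassoc:
  assumes \<gamma>: "trilin sA sH sH sX \<gamma>"
  shows "SA a (\<lambda>x h. SA x (\<lambda>y k. \<gamma> y k h)) = SA a (\<lambda>x h. SH h (\<lambda>k l. \<gamma> x k l))"
proof -
  have vsX: "vector_space sX" using \<gamma> by (simp add: trilin_def bilin_iff)
  have \<gamma>h: "bilin sA sH sX (\<lambda>y k. \<gamma> y k h)" for h using \<gamma> by (simp add: trilin_def)
  have \<delta>: "bilin sAH sH sX (\<lambda>u h. sweedler sH tAH u (\<lambda>y k. \<gamma> y k h))"
    using linear_sweedler_arg[OF tensor_AH \<gamma>h] \<gamma> vs_AH vs_H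
    by (simp add: bilin_iff trilin_def Vector_Spaces.linear_iff sweedler_add sweedler_scale[OF vsX])
  define \<Gamma> where "\<Gamma> z = sweedler sH tAHH z (\<lambda>u h. sweedler sH tAH u (\<lambda>y k. \<gamma> y k h))" for z
  have \<Gamma>: "Vector_Spaces.linear sAHH sX \<Gamma>"
    unfolding \<Gamma>_def by (rule linear_sweedler_arg[OF tensor_AHH \<delta>])
  have \<Gamma>t: "\<Gamma> (tAHH u h) = sweedler sH tAH u (\<lambda>y k. \<gamma> y k h)" for u h
    unfolding \<Gamma>_def by (rule sweedler_tensor[OF tensor_AHH \<delta>])
  have 1: "bilin sA sH sAHH (\<lambda>a h. tAHH (\<alpha> a) h)"
    using bilin_AHH linear_\<alpha> by (auto simp: bilin_iff Vector_Spaces.linear_iff)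
  have 2: "bilin sH sH sAHH (\<lambda>k l. tAHH (tAH v k) l)" for v
    using bilin_AHH bilin_AH by (auto simp: bilin_iff)
  have 3: "bilin sA sH sAHH (\<lambda>v h. SH h (\<lambda>k l. tAHH (tAH v k) l))"
  proof (rule bilin_AI[OF vs_AHH])
    fix x y v w c
    have "Vector_Spaces.linear sH sAHH (\<lambda>h. SH h (\<lambda>k l. tAHH (tAH x k) l))"
      using linear_sweedler_arg[OF tensor_HH 2, of x] linear_\<Delta> by (simp add: Vector_Spaces.linear_iff)
    then show "SH (v + w) (\<lambda>k l. tAHH (tAH x k) l) = SH v (\<lambda>k l. tAHH (tAH x k) l) + SH w (\<lambda>k l. tAHH (tAH x k) l)"
      "SH (sH c w) (\<lambda>k l. tAHH (tAH x k) l) = sAHH c (SH w (\<lambda>k l. tAHH (tAH x k) l))"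
      by (simp_all add: Vector_Spaces.linear_iff)
  qed (use bilin_AHH bilin_AH in \<open>simp_all add: bilin_iff sweedler_add sweedler_scale[OF vs_AHH]\<close>)
  have "SA a (\<lambda>x h. tAHH (\<alpha> x) h) = SA a (\<lambda>v h. SH h (\<lambda>k l. tAHH (tAH v k) l))"
    using comod unfolding comodule_algebra_def id_tensor_assoc_def
    by (simp add: tlift_eq_sweedler[OF tensor_AH 1] tlift_eq_sweedler[OF tensor_HH 2]
        tlift_eq_sweedler[OF tensor_AH 3])
  then have "\<Gamma> (SA a (\<lambda>x h. tAHH (\<alpha> x) h)) = \<Gamma> (SA a (\<lambda>v h. SH h (\<lambda>k l. tAHH (tAH v k) l)))"
    by simp
  then show ?thesis
    by (simp add: linear_sweedler[OF \<Gamma>] \<Gamma>t sweedler_tensor[OF tensor_AH \<gamma>h])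
qed

lemma SA_mult:
  assumes "bilin sA sH sX \<beta>"
  shows "SA (x * y) \<beta> = SA x (\<lambda>a h. SA y (\<lambda>b g. \<beta> (a * b) (h * g)))"
proof -
  have "\<alpha> (x * y) = SA x (\<lambda>a h. SA y (\<lambda>b g. tAH (a * b) (h * g)))"
    using comod tmult_eq_sweedler[OF tensor_AH algebra_A algebra_H]
    unfolding comodule_algebra_def by simp
  then show ?thesis
    by (simp add: linear_sweedler[OF linear_sweedler_arg[OF tensor_AH assms]]
        sweedler_tensor[OF tensor_AH assms])
qed

lemma coact_counit: "SA a (\<lambda>x h. sA (\<epsilon> h) x) = a"
proof -
  have "bilin sA sH sA (\<lambda>x h. sA (\<epsilon> h) x)"
    by (rule bilin_AI[OF vs_A])
      (simp_all add: H_simps vector_space.vector_space_assms[OF vs_A] mult.commute)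
  from tlift_eq_sweedler[OF tensor_AH this] show ?thesis
    using comod unfolding comodule_algebra_def by simp
qed

definition invariant :: "('a \<Rightarrow> 'k) \<Rightarrow> bool" where
  "invariant \<psi> \<longleftrightarrow> Vector_Spaces.linear sA (*) \<psi> \<and> (\<forall>a. SA a (\<lambda>x h. sH (\<psi> x) h) = sH (\<psi> a) 1)"

lemma invariant_iff: "invariant_functional sA sH sAH tAH \<alpha> \<psi> \<longleftrightarrow> invariant \<psi>"
proof (cases "Vector_Spaces.linear sA (*) \<psi>")
  case True
  then have "bilin sA sH sH (\<lambda>x h. sH (\<psi> x) h)"
    by (intro bilin_AI[OF vs_H])
      (simp_all add: Vector_Spaces.linear_iff H_simps mult.commute)
  from tlift_eq_sweedler[OF tensor_AH this] True show ?thesis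
    by (simp add: invariant_def invariant_functional_def)
qed (simp add: invariant_def invariant_functional_def)

lemma invariantD:
  assumes "invariant \<psi>" and f: "Vector_Spaces.linear sH sX f"
  shows "SA a (\<lambda>x h. sX (\<psi> x) (f h)) = sX (\<psi> a) (f 1)"
proof -
  have "SA a (\<lambda>x h. sX (\<psi> x) (f h)) = f (SA a (\<lambda>x h. sH (\<psi> x) h))"
    using f by (simp add: linear_sweedler[OF f] Vector_Spaces.linear_iff)
  then show ?thesis using assms by (simp add: invariant_def Vector_Spaces.linear_iff)
qed

text \<open>Insert \<open>b = b_0 \<epsilon>(b_1)\<close> on the right, write the counit as a
  product \<open>k * S m\<close>, and regroup until the coaction of \<open>a * y\<close> appears;
  invariance then removes its \<open>H\<close>-leg and leaves only the antipode.\<close>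

lemma strong_invariance:
  assumes inv: "invariant \<psi>"
  shows "SA b (\<lambda>y h. sH (\<psi> (a * y)) (S h)) = SA a (\<lambda>x h. sH (\<psi> (x * b)) h)"
proof -
  have \<psi>: "Vector_Spaces.linear sA (*) \<psi>" using inv by (simp add: invariant_def)
  note simps = H_simps algebra_scale_mult[OF algebra_A] vector_space.vector_space_assms[OF vs_A]
  have lin: "Vector_Spaces.linear sA sH (\<lambda>z. sH (\<psi> (x * z)) h)" for x h
    using \<psi> vs_A vs_H by (simp add: Vector_Spaces.linear_iff simps)
  have tri: "trilin sA sH sH sH (\<lambda>z k l. sH (\<psi> (x * z)) (h * (k * S l)))" for x h
    using \<psi> by (intro trilin_AI[OF vs_H])
      (simp_all add: simps Vector_Spaces.linear_iff mult.commute)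
  have bil: "bilin sA sH sH (\<lambda>z k. sH (\<psi> z) (k * S l))" for l
    using \<psi> by (intro bilin_AI[OF vs_H])
      (simp_all add: simps Vector_Spaces.linear_iff mult.commute)
  have linS: "Vector_Spaces.linear sH sH (\<lambda>k. k * S l)" for l
    using vs_H by (simp add: Vector_Spaces.linear_iff simps)
  have linh: "Vector_Spaces.linear sH sH (\<lambda>k. sH c (h * k))" for c h
    using vs_H by (simp add: Vector_Spaces.linear_iff simps mult.commute)
  have "SA a (\<lambda>x h. sH (\<psi> (x * b)) h)
      = SA a (\<lambda>x h. sH (\<psi> (x * SA b (\<lambda>y l. sA (\<epsilon> l) y))) h)"
    by (simp add: coact_counit)
  also have "\<dots> = SA a (\<lambda>x h. SA b (\<lambda>y l. sH (\<psi> (x * y)) (h * sH (\<epsilon> l) 1)))"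
    using \<psi> by (simp add: linear_sweedler[OF lin] simps Vector_Spaces.linear_iff mult.commute)
  also have "\<dots> = SA a (\<lambda>x h. SA b (\<lambda>y l. SH l (\<lambda>k m. sH (\<psi> (x * y)) (h * (k * S m)))))"
    by (simp add: linear_sweedler[OF linh] flip: antipode_right)
  \<comment> \<open>Coassociativity hands the factor \<open>k\<close> to the coaction of
    \<open>y\<close>, ready to be merged with that of \<open>a\<close>.\<close>
  also have "\<dots> = SA a (\<lambda>x h. SA b (\<lambda>y l. SA y (\<lambda>z k. sH (\<psi> (x * z)) (h * (k * S l)))))"
    by (simp add: coassoc[OF tri])
  also have "\<dots> = SA b (\<lambda>y l. SA a (\<lambda>x h. SA y (\<lambda>z k. sH (\<psi> (x * z)) (h * k * S l))))"
    by (subst sweedler_swap) (simp add: mult.assoc)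
  also have "\<dots> = SA b (\<lambda>y l. SA (a * y) (\<lambda>z k. sH (\<psi> z) (k * S l)))"
    by (simp add: SA_mult[OF bil])
  also have "\<dots> = SA b (\<lambda>y l. sH (\<psi> (a * y)) (S l))"
    by (simp add: invariantD[OF inv linS])
  finally show ?thesis ..
qed

end

section \<open>Integrals on Hopf algebras\<close>

context hopf
begin

text \<open>Via its coproduct \<open>H\<close> is a comodule algebra over itself, so the comodule
  lemmas specialise to \<open>H\<close>; its invariant functionals are the right integrals.\<close>

lemma regular: "hopf_comodule sH sHH sHHH tHH tHHH \<Delta> \<epsilon> S sH sHH sHHH tHH tHHH \<Delta>"
  using hopf by unfold_locales (simp_all add: hopf_algebra_def comodule_algebra_def)

lemmas trilin_HI = hopf_comodule.trilin_AI[OF regular]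
lemmas SH_coassoc = hopf_comodule.coassoc[OF regular]
lemmas SH_mult = hopf_comodule.SA_mult[OF regular]
lemmas linear_SH = hopf_comodule.linear_SA[OF regular]

section \<open>Left and right integrals, strong invariance, uniqueness\<close>

definition left_integral :: "('h \<Rightarrow> 'k) \<Rightarrow> bool" where
  "left_integral \<phi> \<longleftrightarrow> functional \<phi> \<and> (\<forall>h. SH h (\<lambda>a b. sH (\<phi> b) a) = sH (\<phi> h) 1)"

definition right_integral :: "('h \<Rightarrow> 'k) \<Rightarrow> bool" where
  "right_integral \<psi> \<longleftrightarrow> functional \<psi> \<and> (\<forall>h. SH h (\<lambda>a b. sH (\<psi> a) b) = sH (\<psi> h) 1)"

lemma left_integral_linear: "left_integral \<phi> \<Longrightarrow> functional \<phi>"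
  and right_integral_linear: "right_integral \<psi> \<Longrightarrow> functional \<psi>"
  by (simp_all add: left_integral_def right_integral_def)

lemma invariant_functionals_integrals:
  assumes "has_invariant_functionals sH sHH tHH \<Delta>"
  obtains \<phi> \<psi> a b where "left_integral \<phi>" "right_integral \<psi>" "\<phi> a = 1" "\<psi> b = 1"
proof -
  obtain \<phi> \<psi> a b where \<phi>: "functional \<phi>" and \<psi>: "functional \<psi>" and nz: "\<phi> a \<noteq> 0" "\<psi> b \<noteq> 0"
    and inv: "\<And>h. tlift sHH sH tHH (\<lambda>a b. sH (\<phi> b) a) (\<Delta> h) = sH (\<phi> h) 1"
      "\<And>h. tlift sHH sH tHH (\<lambda>a b. sH (\<psi> a) b) (\<Delta> h) = sH (\<psi> h) 1"
    using assms unfolding has_invariant_functionals_def by blast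
  have 1: "bilin sH sH sH (\<lambda>a b. sH (\<phi> b) a)" and 2: "bilin sH sH sH (\<lambda>a b. sH (\<psi> a) b)"
    using \<phi> \<psi> by (auto intro!: bilin_HI[OF vs_H] simp: Vector_Spaces.linear_iff H_simps mult.commute)
  have "left_integral \<phi>" "right_integral \<psi>"
    using inv \<phi> \<psi> unfolding tlift_eq_sweedler[OF tensor_HH 1] tlift_eq_sweedler[OF tensor_HH 2]
    by (simp_all add: left_integral_def right_integral_def)
  moreover have "\<phi> (sH (inverse (\<phi> a)) a) = 1" "\<psi> (sH (inverse (\<psi> b)) b) = 1"
    using \<phi> \<psi> nz by (simp_all add: Vector_Spaces.linear_iff)
  ultimately show thesis using that by blast
qed

lemma left_integralD:
  assumes "left_integral \<phi>" and f: "Vector_Spaces.linear sH sX f"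
  shows "SH h (\<lambda>a b. sX (\<phi> b) (f a)) = sX (\<phi> h) (f 1)"
proof -
  have "SH h (\<lambda>a b. sX (\<phi> b) (f a)) = f (SH h (\<lambda>a b. sH (\<phi> b) a))"
    using f by (simp add: linear_sweedler[OF f] Vector_Spaces.linear_iff)
  then show ?thesis using assms by (simp add: left_integral_def Vector_Spaces.linear_iff)
qed

lemma right_integralD:
  assumes "right_integral \<psi>" and f: "Vector_Spaces.linear sH sX f"
  shows "SH h (\<lambda>a b. sX (\<psi> a) (f b)) = sX (\<psi> h) (f 1)"
proof -
  have "SH h (\<lambda>a b. sX (\<psi> a) (f b)) = f (SH h (\<lambda>a b. sH (\<psi> a) b))"
    using f by (simp add: linear_sweedler[OF f] Vector_Spaces.linear_iff)
  then show ?thesis using assms by (simp add: right_integral_def Vector_Spaces.linear_iff)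
qed

lemma right_strong_invariance:
  assumes "right_integral \<psi>"
  shows "SH b (\<lambda>y h. sH (\<psi> (a * y)) (S h)) = SH a (\<lambda>x h. sH (\<psi> (x * b)) h)"
  using assms hopf_comodule.strong_invariance[OF regular, of \<psi>]
  unfolding hopf_comodule.invariant_def[OF regular] right_integral_def by simp

text \<open>Mirror image of \<open>right_strong_invariance\<close>, paired with a functional
  \<open>f\<close>. Left invariance turns \<open>S(a_1) \<phi>(a_2 b)\<close> into
  \<open>S(a_1) a_2 b_1 \<phi>(a_3 b_2)\<close>, where the antipode axiom removes the first two
  factors.\<close>

lemma left_strong_invariance:
  assumes \<phi>: "left_integral \<phi>" and f: "functional f"
  shows "SH b (\<lambda>k l. \<phi> (a * l) * f k) = SH a (\<lambda>k l. \<phi> (l * b) * f (S k))"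
proof -
  note lin = left_integral_linear[OF \<phi>] f
  note simps = H_simps Vector_Spaces.linear_iff sweedler_add
    sweedler_scale[OF vector_space_times] mult_ac vector_space_times
  have linf: "functional (\<lambda>x. f (S k * x))" for k
    using lin vs_H by (simp add: simps)
  have bil: "bilin sH sH (*) (\<lambda>u v. \<phi> v * f (S k * u))" for k
    using lin by (intro bilin_HI vector_space_times) (simp_all add: simps)
  have tri: "trilin sH sH sH (*) (\<lambda>k p q. SH b (\<lambda>u v. \<phi> (q * v) * f (S k * (p * u))))"
    using lin by (intro trilin_HI vector_space_times) (simp_all add: simps)
  have linS: "functional (\<lambda>x. c * f (x * u))" for c u
    using lin vs_H by (simp add: simps)
  have S: "SH k (\<lambda>k' p. c * f (S k' * (p * u))) = \<epsilon> k * (c * f u)" for k c u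
  proof -
    have "SH k (\<lambda>k' p. c * f (S k' * (p * u))) = SH k (\<lambda>k' p. c * f ((S k' * p) * u))"
      by (simp add: mult.assoc)
    also have "\<dots> = c * f (sH (\<epsilon> k) 1 * u)"
      by (simp add: linear_sweedler[OF linS, symmetric] antipode_left)
    finally show ?thesis using lin by (simp add: H_simps Vector_Spaces.linear_iff)
  qed
  have lin\<phi>: "functional (\<lambda>x. \<phi> (x * v) * c)" for v c
    using lin vs_H by (simp add: simps)
  have "SH a (\<lambda>k l. \<phi> (l * b) * f (S k)) = SH a (\<lambda>k l. SH (l * b) (\<lambda>u v. \<phi> v * f (S k * u)))"
    by (simp add: left_integralD[OF \<phi> linf])
  also have "\<dots> = SH a (\<lambda>k l. SH l (\<lambda>p q. SH b (\<lambda>u v. \<phi> (q * v) * f (S k * (p * u)))))"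
    by (simp add: SH_mult[OF bil])
  also have "\<dots> = SH a (\<lambda>k l. SH k (\<lambda>k' p. SH b (\<lambda>u v. \<phi> (l * v) * f (S k' * (p * u)))))"
    by (rule SH_coassoc[OF tri, symmetric])
  also have "\<dots> = SH a (\<lambda>k l. SH b (\<lambda>u v. SH k (\<lambda>k' p. \<phi> (l * v) * f (S k' * (p * u)))))"
    by (subst sweedler_swap) simp
  also have "\<dots> = SH b (\<lambda>u v. SH a (\<lambda>k l. \<epsilon> k * (\<phi> (l * v) * f u)))"
    by (subst sweedler_swap) (simp add: S)
  also have "\<dots> = SH b (\<lambda>u v. \<phi> (SH a (\<lambda>k l. sH (\<epsilon> k) l) * v) * f u)"
    using lin by (simp add: linear_sweedler[OF lin\<phi>] H_simps Vector_Spaces.linear_iff mult.assoc)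
  finally show ?thesis by (simp add: counit_left)
qed

text \<open>Both sides evaluate \<open>\<psi>(b_1) \<phi>(a b_2)\<close>: once by right invariance
  of \<psi>, once by strong invariance of \<phi>.\<close>

lemma integrals_product:
  assumes \<phi>: "left_integral \<phi>" and \<psi>: "right_integral \<psi>"
  shows "\<phi> a * \<psi> b = SH a (\<lambda>k l. \<phi> (l * b) * \<psi> (S k))"
proof -
  have lin: "functional (\<lambda>x. \<phi> (a * x))"
    using left_integral_linear[OF \<phi>] by (simp add: Vector_Spaces.linear_iff H_simps)
  show ?thesis
    using right_integralD[OF \<psi> lin, of b] left_strong_invariance[OF \<phi> right_integral_linear[OF \<psi>], of b a]
    by (simp add: mult.commute)
qed

text \<open>The mirrored computation, with \<open>\<psi>(a_1 b) \<phi>(a_2)\<close> evaluated in two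
  ways.\<close>

lemma integrals_product':
  assumes \<phi>: "left_integral \<phi>" and \<psi>: "right_integral \<psi>"
  shows "\<phi> a * \<psi> b = SH b (\<lambda>k l. \<psi> (a * k) * \<phi> (S l))"
proof -
  have lin: "functional (\<lambda>x. \<psi> (x * b))"
    using right_integral_linear[OF \<psi>] by (simp add: Vector_Spaces.linear_iff H_simps)
  have "SH b (\<lambda>k l. \<psi> (a * k) * \<phi> (S l)) = \<phi> (SH b (\<lambda>y h. sH (\<psi> (a * y)) (S h)))"
    using left_integral_linear[OF \<phi>] by (simp add: linear_sweedler[of sH "(*)" \<phi>] Vector_Spaces.linear_iff)
  also have "\<dots> = SH a (\<lambda>x h. \<phi> h * \<psi> (x * b))"
    using left_integral_linear[OF \<phi>]
    by (simp add: right_strong_invariance[OF \<psi>] linear_sweedler[of sH "(*)" \<phi>] Vector_Spaces.linear_iff mult.commute)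
  finally show ?thesis using left_integralD[OF \<phi> lin, of a] by simp
qed

text \<open>The point is that the element \<open>\<phi>(h_1) S(h_2)\<close> does not depend on the
  right integral \<psi>, which is the key to uniqueness. After \<open>integrals_product\<close> the
  coproduct leg \<open>l\<close> cancels against \<open>S b\<close>.\<close>

lemma right_integral_antipode:
  assumes \<phi>: "left_integral \<phi>" and \<psi>: "right_integral \<psi>"
  shows "SH h (\<lambda>a b. \<phi> a * \<psi> (S b * c)) = \<psi> (S h) * \<phi> c"
proof -
  note lin = left_integral_linear[OF \<phi>] right_integral_linear[OF \<psi>]
  have tri: "trilin sH sH sH (*) (\<lambda>k l b. \<phi> (l * (S b * c)) * \<psi> (S k))"
    using lin by (intro trilin_HI vector_space_times)
      (simp_all add: H_simps Vector_Spaces.linear_iff mult_ac)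
  have linc: "functional (\<lambda>x. \<phi> (x * c) * d)" for d
    using lin vs_H by (simp add: H_simps Vector_Spaces.linear_iff mult_ac)
  have "\<phi> a * \<psi> (S b * c) = SH a (\<lambda>k l. \<phi> (l * (S b * c)) * \<psi> (S k))" for a b
    by (rule integrals_product[OF \<phi> \<psi>])
  then have "SH h (\<lambda>a b. \<phi> a * \<psi> (S b * c)) = SH h (\<lambda>a b. SH a (\<lambda>k l. \<phi> (l * (S b * c)) * \<psi> (S k)))"
    by (simp only:)
  also have "\<dots> = SH h (\<lambda>a b. SH b (\<lambda>k l. \<phi> ((k * S l) * c) * \<psi> (S a)))"
    by (subst SH_coassoc[OF tri]) (simp add: mult.assoc)
  also have "\<dots> = SH h (\<lambda>a b. \<phi> c * \<psi> (S (sH (\<epsilon> b) a)))"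
    by (simp only: linear_sweedler[OF linc, symmetric] antipode_right)
      (use lin in \<open>simp add: H_simps Vector_Spaces.linear_iff mult_ac\<close>)
  also have "\<dots> = \<phi> c * \<psi> (S (SH h (\<lambda>a b. sH (\<epsilon> b) a)))"
    by (rule linear_sweedler[symmetric, of sH "(*)" "\<lambda>x. \<phi> c * \<psi> (S x)"])
      (use lin in \<open>simp add: H_simps Vector_Spaces.linear_iff mult_ac\<close>)
  finally show ?thesis by (simp add: counit_right mult.commute)
qed

text \<open>For \<open>\<psi> c = 1\<close> this expresses \<phi> after \<open>S\<close> through the
  element \<open>h_1 \<psi>(h_2)\<close>, as needed in \<open>modular_grouplike_antipode\<close>.
  After \<open>integrals_product'\<close> the factors \<open>S k * l\<close> cancel.\<close>

lemma left_integral_antipode: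
  assumes \<phi>: "left_integral \<phi>" and \<psi>: "right_integral \<psi>"
  shows "SH h (\<lambda>a b. \<phi> (c * S a) * \<psi> b) = \<psi> c * \<phi> (S h)"
proof -
  note lin = left_integral_linear[OF \<phi>] right_integral_linear[OF \<psi>]
  have tri: "trilin sH sH sH (*) (\<lambda>a k l. \<psi> (c * S a * k) * \<phi> (S l))"
    using lin by (intro trilin_HI vector_space_times)
      (simp_all add: H_simps Vector_Spaces.linear_iff mult_ac)
  have linc: "functional (\<lambda>x. \<psi> (c * x) * d)" for d
    using lin vs_H by (simp add: H_simps Vector_Spaces.linear_iff mult_ac)
  have "SH h (\<lambda>a b. \<phi> (c * S a) * \<psi> b) = SH h (\<lambda>a b. SH b (\<lambda>k l. \<psi> (c * S a * k) * \<phi> (S l)))"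
    by (simp add: integrals_product'[OF \<phi> \<psi>])
  also have "\<dots> = SH h (\<lambda>a b. SH a (\<lambda>k l. \<psi> (c * (S k * l)) * \<phi> (S b)))"
    by (subst SH_coassoc[OF tri, symmetric]) (simp add: mult.assoc)
  also have "\<dots> = SH h (\<lambda>a b. \<psi> c * \<phi> (S (sH (\<epsilon> a) b)))"
    by (simp only: linear_sweedler[OF linc, symmetric] antipode_left)
      (use lin in \<open>simp add: H_simps Vector_Spaces.linear_iff mult_ac\<close>)
  also have "\<dots> = \<psi> c * \<phi> (S (SH h (\<lambda>a b. sH (\<epsilon> a) b)))"
    by (rule linear_sweedler[symmetric, of sH "(*)" "\<lambda>x. \<psi> c * \<phi> (S x)"])
      (use lin in \<open>simp add: H_simps Vector_Spaces.linear_iff mult_ac\<close>)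
  finally show ?thesis by (simp add: counit_left)
qed

text \<open>The first legs of the coproduct of \<open>y\<close> inherit the vanishing: strong
  invariance gives a vanishing combination of the independent second legs, with coefficients
  \<open>\<psi> (m c * x)\<close>. The antipode then recovers \<open>\<psi>(b) y\<close> from these
  legs.\<close>

lemma right_integral_faithful:
  assumes \<psi>: "right_integral \<psi>" and nz: "\<psi> b \<noteq> 0" and y: "\<And>c. \<psi> (y * c) = 0"
  shows "y = 0"
proof -
  interpret vector_space sH by (rule vs_H)
  note lin = right_integral_linear[OF \<psi>]
  define C m where "C = fst (tensor_rep sH tHH (\<Delta> y))" and "m = snd (tensor_rep sH tHH (\<Delta> y))"
  note rep = tensor_rep[OF tensor_HH, of "\<Delta> y", folded C_def m_def]
  have SH: "SH y \<beta> = (\<Sum>c\<in>C. \<beta> (m c) c)" for \<beta> :: "'h \<Rightarrow> 'h \<Rightarrow> 'h"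
    by (simp add: sweedler_def C_def m_def)
  have zero: "\<psi> (m c * x) = 0" if "c \<in> C" for c x
  proof -
    have "(\<Sum>c\<in>C. sH (\<psi> (m c * x)) c) = SH x (\<lambda>k h. sH (\<psi> (y * k)) (S h))"
      unfolding right_strong_invariance[OF \<psi>] SH ..
    also have "\<dots> = 0" by (simp add: y sweedler_def)
    finally show ?thesis
      using independentD[OF rep(2,1) order_refl, of "\<lambda>c. \<psi> (m c * x)"] that by simp
  qed
  have tri: "trilin sH sH sH sH (\<lambda>u k l. sH (\<psi> (u * S k * b)) l)"
    using lin by (intro trilin_HI vs_H) (simp_all add: H_simps Vector_Spaces.linear_iff mult_ac)
  have linb: "Vector_Spaces.linear sH sH (\<lambda>x. sH (\<psi> (x * b)) v)" for v
    using lin vs_H by (simp add: H_simps Vector_Spaces.linear_iff)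
  \<comment> \<open>The sum \<open>\<psi>(y_1 S(y_2) b) y_3\<close> vanishes term by term, and it
    also equals \<open>\<psi>(b) y\<close>.\<close>
  have "0 = SH y (\<lambda>u v. SH v (\<lambda>k l. sH (\<psi> (u * S k * b)) l))"
    unfolding SH using zero by (simp add: sweedler_def mult.assoc)
  also have "\<dots> = SH y (\<lambda>u v. SH u (\<lambda>k l. sH (\<psi> ((k * S l) * b)) v))"
    by (rule SH_coassoc[OF tri, symmetric])
  also have "\<dots> = SH y (\<lambda>u v. sH (\<psi> b) (sH (\<epsilon> u) v))"
    by (simp only: linear_sweedler[OF linb, symmetric] antipode_right)
      (use lin in \<open>simp add: H_simps Vector_Spaces.linear_iff mult_ac\<close>)
  also have "\<dots> = sH (\<psi> b) y"
    by (simp only: sweedler_scale[OF vs_H] counit_left)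
  finally show ?thesis using nz by simp
qed

text \<open>A combination \<chi> of the two right integrals vanishing at \<open>S h\<close> vanishes
  on all multiples \<open>y * x\<close> of \<open>y = \<phi>(h_1) S(h_2)\<close>. If \<chi> were
  nonzero, faithfulness would force \<open>y = 0\<close>, against
  \<open>\<psi>(y a) = \<psi>(S h) \<phi>(a)\<close>.\<close>

lemma right_integral_unique:
  assumes \<phi>: "left_integral \<phi>" "\<phi> a \<noteq> 0" and \<psi>: "right_integral \<psi>" "\<psi> b \<noteq> 0"
    and \<psi>': "right_integral \<psi>'"
  obtains c where "\<And>h. \<psi>' h = c * \<psi> h"
proof -
  note lin = right_integral_linear[OF \<psi>(1)] right_integral_linear[OF \<psi>']
  have "\<exists>h. \<psi> (S h) \<noteq> 0"
  proof (rule ccontr)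
    assume "\<not> ?thesis"
    then have "\<phi> a * \<psi> b = 0"
      by (subst integrals_product[OF \<phi>(1) \<psi>(1)]) (simp add: sweedler_def)
    with \<phi> \<psi> show False by simp
  qed
  then obtain h where h: "\<psi> (S h) \<noteq> 0" by auto
  \<comment> \<open>Chosen so that \<chi> vanishes at \<open>S h\<close>.\<close>
  define c where "c = \<psi>' (S h) / \<psi> (S h)"
  define \<chi> where "\<chi> x = \<psi>' x - c * \<psi> x" for x
  have \<chi>: "right_integral \<chi>"
    unfolding right_integral_def
  proof (intro conjI allI)
    show "functional \<chi>" using lin unfolding \<chi>_def by (simp add: Vector_Spaces.linear_iff algebra_simps)
    fix x
    interpret vector_space sH by (rule vs_H)
    have "SH x (\<lambda>a b. sH (\<chi> a) b) = SH x (\<lambda>a b. sH (\<psi>' a) b) - sH c (SH x (\<lambda>a b. sH (\<psi> a) b))"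
      unfolding \<chi>_def by (simp add: sweedler_def scale_left_diff_distrib sum_subtractf scale_sum_right)
    then show "SH x (\<lambda>a b. sH (\<chi> a) b) = sH (\<chi> x) 1"
      using \<psi>(1) \<psi>' by (simp add: right_integral_def \<chi>_def scale_left_diff_distrib)
  qed
  define y where "y = SH h (\<lambda>a b. sH (\<phi> a) (S b))"
  have y: "\<xi> (y * x) = \<xi> (S h) * \<phi> x" if \<xi>: "right_integral \<xi>" for \<xi> x
  proof -
    have l: "functional (\<lambda>z. \<xi> (z * x))"
      using right_integral_linear[OF \<xi>] by (simp add: Vector_Spaces.linear_iff H_simps)
    show ?thesis unfolding y_def linear_sweedler[OF l]
      using right_integral_antipode[OF \<phi>(1) \<xi>, of h x] right_integral_linear[OF \<xi>]
      by (simp add: Vector_Spaces.linear_iff H_simps)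
  qed
  have "\<chi> x = 0" for x
  proof (rule ccontr)
    assume "\<chi> x \<noteq> 0"
    moreover have "\<chi> (S h) = 0" using h by (simp add: \<chi>_def c_def)
    ultimately have "y = 0" using right_integral_faithful[OF \<chi>, of x y] y[OF \<chi>] by simp
    with y[OF \<psi>(1), of a] h \<phi>(2) linear_zero_eq[OF lin(1)] show False by simp
  qed
  then show thesis using that[of c] by (simp add: \<chi>_def)
qed

section \<open>Grouplike elements and the modular element\<close>

definition grouplike :: "'h \<Rightarrow> bool" where
  "grouplike g \<longleftrightarrow> \<Delta> g = tHH g g \<and> \<epsilon> g = 1"

lemma SH_grouplike: "grouplike g \<Longrightarrow> bilin sH sH sX \<beta> \<Longrightarrow> SH g \<beta> = \<beta> g g"
  using sweedler_tensor[OF tensor_HH] by (simp add: grouplike_def)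

lemma grouplike_one: "grouplike 1"
  using hopf unfolding hopf_algebra_def grouplike_def by auto

text \<open>The antipode axioms at \<open>g\<close> give the inverse. The coproduct of
  \<open>S g\<close> is found by multiplying
  \<open>\<Delta>(S g) \<Delta>(g) = 1 \<otimes> 1\<close> on the right by
  \<open>S g \<otimes> S g\<close>.\<close>

lemma grouplike_inverse:
  assumes g: "grouplike g"
  shows "g * S g = 1" "S g * g = 1" "grouplike (S g)"
proof -
  have "bilin sH sH sH (\<lambda>a b. a * S b)" "bilin sH sH sH (\<lambda>a b. S a * b)"
    by (rule bilin_HI[OF vs_H]; simp add: H_simps)+
  from this[THEN SH_grouplike[OF g]] show gS: "g * S g = 1" and Sg: "S g * g = 1"
    using antipode_left[of g] antipode_right[of g] g vector_space.vector_space_assms(4)[OF vs_H]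
    by (simp_all add: grouplike_def)
  have bil: "bilin sH sH sHH (\<lambda>a b. tHH (a * u) (b * u))" for u
    using bilin_HH by (intro bilin_HI[OF vs_HH]) (simp_all add: bilin_iff H_simps)
  have bil': "bilin sH sH sHH (\<lambda>a b. tHH (c * a * u) (d * b * u))" for c d u
    using bilin_HH by (intro bilin_HI[OF vs_HH]) (simp_all add: bilin_iff H_simps)
  have "\<Delta> (S g) = SH (S g) tHH" by (simp add: sweedler_self[OF tensor_HH])
  also have "\<dots> = SH (S g) (\<lambda>a b. SH g (\<lambda>c d. tHH (a * c * S g) (b * d * S g)))"
    by (simp only: SH_grouplike[OF g bil']) (simp add: mult.assoc gS)
  also have "\<dots> = SH (S g * g) (\<lambda>a b. tHH (a * S g) (b * S g))"
    by (rule SH_mult[OF bil, symmetric])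
  also have "\<dots> = tHH (S g) (S g)"
    by (simp add: Sg SH_one[OF bil])
  finally have "\<Delta> (S g) = tHH (S g) (S g)" .
  moreover have "\<epsilon> g * \<epsilon> (S g) = 1" by (metis gS counit_mult counit_one)
  ultimately show "grouplike (S g)" using g by (simp add: grouplike_def)
qed

text \<open>For every functional \<theta> the functional \<open>\<theta>(h_1) \<psi>(h_2)\<close> is
  again a right integral, hence a multiple of \<psi>. So \<open>h_1 \<psi>(h_2)\<close> is
  \<open>\<psi>(h)\<close> times a fixed element, and coassociativity makes that element
  grouplike.\<close>

lemma modular_grouplike:
  assumes \<phi>: "left_integral \<phi>" "\<phi> a \<noteq> 0" and \<psi>: "right_integral \<psi>" "\<psi> b = 1"
  obtains g where "grouplike g" "\<And>h. SH h (\<lambda>k l. sH (\<psi> l) k) = sH (\<psi> h) g"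
proof -
  note lin = right_integral_linear[OF \<psi>(1)]
  define R where "R h = SH h (\<lambda>k l. sH (\<psi> l) k)" for h
  \<comment> \<open>Since \<open>\<psi> b = 1\<close>, the fixed element can only be the value of
    \<open>R\<close> at \<open>b\<close>.\<close>
  define g where "g = R b"
  have R: "R h = sH (\<psi> h) g" for h
  proof (rule functional_eqI[OF vs_H])
    fix \<theta> assume \<theta>: "functional \<theta>"
    define \<chi> where "\<chi> h = SH h (\<lambda>k l. \<theta> k * \<psi> l)" for h
    have bil: "bilin sH sH (*) (\<lambda>k l. \<theta> k * \<psi> l)"
      using \<theta> lin by (intro bilin_HI vector_space_times) (simp_all add: Vector_Spaces.linear_iff algebra_simps)
    have tri: "trilin sH sH sH sH (\<lambda>u k l. sH (\<theta> u * \<psi> k) l)"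
      using \<theta> lin by (intro trilin_HI vs_H) (simp_all add: H_simps Vector_Spaces.linear_iff mult_ac)
    have \<chi>lin: "functional \<chi>" unfolding \<chi>_def by (rule linear_SH[OF bil])
    have scale_lin: "Vector_Spaces.linear (*) sH (\<lambda>c. sH c v)" for v
      using vs_H vector_space_times by (simp add: Vector_Spaces.linear_iff H_simps)
    have "SH h (\<lambda>a b. sH (\<chi> a) b) = sH (\<chi> h) 1" for h
    proof -
      have "SH h (\<lambda>a b. sH (\<chi> a) b) = SH h (\<lambda>a b. SH a (\<lambda>k l. sH (\<theta> k * \<psi> l) b))"
        unfolding \<chi>_def by (simp add: linear_sweedler[OF scale_lin])
      also have "\<dots> = SH h (\<lambda>a b. SH b (\<lambda>k l. sH (\<theta> a * \<psi> k) l))"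
        by (rule SH_coassoc[OF tri])
      also have "\<dots> = SH h (\<lambda>a b. sH (\<theta> a) (SH b (\<lambda>k l. sH (\<psi> k) l)))"
        by (simp add: sweedler_scale[OF vs_H, symmetric] H_simps)
      also have "\<dots> = SH h (\<lambda>a b. sH (\<theta> a * \<psi> b) 1)"
        using \<psi> by (simp add: right_integral_def H_simps)
      finally show ?thesis unfolding \<chi>_def by (simp add: linear_sweedler[OF scale_lin])
    qed
    with \<chi>lin have "right_integral \<chi>" by (simp add: right_integral_def)
    then obtain c where c: "\<And>h. \<chi> h = c * \<psi> h"
      using right_integral_unique[OF \<phi> \<psi>(1)] \<psi>(2) by (metis one_neq_zero)
    have "\<theta> (R h) = \<chi> h" for h
      unfolding R_def \<chi>_def linear_sweedler[OF \<theta>] using \<theta>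
      by (simp add: Vector_Spaces.linear_iff mult.commute)
    with c \<psi>(2) show "\<theta> (R h) = \<theta> (sH (\<psi> h) g)"
      using \<theta> by (simp add: g_def Vector_Spaces.linear_iff mult.commute)
  qed
  have bil: "bilin sH sH sHH tHH" by (rule bilin_HH)
  have tri: "trilin sH sH sH sHH (\<lambda>u k l. sHH (\<psi> l) (tHH u k))"
    using bil lin vector_space.vector_space_assms[OF vs_HH]
    by (intro trilin_HI vs_HH) (simp_all add: bilin_iff H_simps Vector_Spaces.linear_iff mult_ac)
  have lin1: "Vector_Spaces.linear sH sHH (\<lambda>x. tHH x v)" and lin2: "Vector_Spaces.linear sH sHH (tHH v)" for v
    using bil by (simp_all add: bilin_def)
  have "\<Delta> g = SH b (\<lambda>u v. SH u (\<lambda>k l. sHH (\<psi> v) (tHH k l)))"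
    unfolding g_def R_def linear_sweedler[OF linear_\<Delta>] using linear_\<Delta>
    by (simp add: Vector_Spaces.linear_iff sweedler_scale[OF vs_HH] sweedler_self[OF tensor_HH])
  also have "\<dots> = SH b (\<lambda>u v. SH v (\<lambda>k l. sHH (\<psi> l) (tHH u k)))"
    by (rule SH_coassoc[OF tri])
  also have "\<dots> = SH b (\<lambda>u v. tHH u (R v))"
    using bil by (simp add: R_def linear_sweedler[OF lin2] bilin_iff)
  also have "\<dots> = SH b (\<lambda>u v. tHH (sH (\<psi> v) u) g)"
    using bil by (simp add: R bilin_iff)
  also have "\<dots> = tHH g g"
    by (simp add: g_def R_def linear_sweedler[OF lin1])
  finally have "\<Delta> g = tHH g g" .
  moreover have "\<epsilon> g = \<psi> (SH b (\<lambda>k l. sH (\<epsilon> k) l))"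
    unfolding g_def R_def linear_sweedler[OF linear_\<epsilon>] linear_sweedler[OF lin]
    using lin linear_\<epsilon> by (simp add: Vector_Spaces.linear_iff mult.commute)
  then have "\<epsilon> g = 1" using \<psi>(2) by (simp add: counit_left)
  ultimately show thesis using that[of g] R by (simp add: grouplike_def R_def)
qed

text \<open>By \<open>left_integral_antipode\<close>, \<phi> after \<open>S\<close> is a scalar
  multiple of \<psi>, so it has the same modular grouplike.\<close>

lemma modular_grouplike_antipode:
  assumes \<phi>: "left_integral \<phi>" "\<phi> a \<noteq> 0" and \<psi>: "right_integral \<psi>" "\<psi> b = 1"
  obtains g where "grouplike g" "\<And>h. SH h (\<lambda>k l. sH (\<phi> (S l)) k) = sH (\<phi> (S h)) g"
proof -
  obtain g where g: "grouplike g" "\<And>h. SH h (\<lambda>k l. sH (\<psi> l) k) = sH (\<psi> h) g"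
    using modular_grouplike[OF \<phi> \<psi>] by blast
  have "\<phi> (S h) = \<phi> (b * S g) * \<psi> h" for h
  proof -
    have l: "functional (\<lambda>x. \<phi> (b * S x))"
      using left_integral_linear[OF \<phi>(1)] by (simp add: Vector_Spaces.linear_iff H_simps)
    have "\<phi> (S h) = \<phi> (b * S (SH h (\<lambda>k l. sH (\<psi> l) k)))"
      using left_integral_antipode[OF \<phi>(1) \<psi>(1), of h b] \<psi>(2) left_integral_linear[OF \<phi>(1)]
      by (simp add: linear_sweedler[OF l] H_simps Vector_Spaces.linear_iff mult.commute)
    then show ?thesis
      using left_integral_linear[OF \<phi>(1)] by (simp add: g(2) H_simps Vector_Spaces.linear_iff mult.commute)
  qed
  then have "SH h (\<lambda>k l. sH (\<phi> (S l)) k) = sH (\<phi> (S h)) g" for h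
    using g(2)[of h] sweedler_scale[OF vs_H, of sH tHH "\<Delta> h" "\<phi> (b * S g)" "\<lambda>k l. sH (\<psi> l) k"]
    by (simp add: H_simps)
  with g(1) that show thesis by blast
qed

end

section \<open>Homogeneous elements of Galois objects\<close>

text \<open>The coproduct of \<open>x' * h\<close> has first leg \<open>x' h_1\<close>, so left
  invariance at \<open>x' * h\<close>, multiplied by \<open>x\<close>, makes the translated
  functional fit for \<open>slice_homogeneous\<close>.\<close>

lemma (in hopf) left_integral_translate:
  assumes \<phi>: "left_integral \<phi>" and x': "grouplike x'" and inv: "x * x' = 1"
  shows "SH h (\<lambda>k l. sH (\<phi> (x' * l)) k) = sH (\<phi> (x' * h)) x"
proof -
  note lin = left_integral_linear[OF \<phi>]
  have linx: "Vector_Spaces.linear sH sH (\<lambda>k. x * k)"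
    using vs_H by (simp add: Vector_Spaces.linear_iff H_simps)
  have bil: "bilin sH sH sH (\<lambda>k l. sH (\<phi> l) (x * k))"
    using lin by (intro bilin_HI vs_H) (simp_all add: Vector_Spaces.linear_iff H_simps mult_ac)
  have bil': "bilin sH sH sH (\<lambda>k l. SH h (\<lambda>p q. sH (\<phi> (l * q)) (x * (k * p))))"
    using lin by (intro bilin_HI vs_H)
      (simp_all add: Vector_Spaces.linear_iff H_simps mult_ac sweedler_add sweedler_scale[OF vs_H, symmetric])
  have "sH (\<phi> (x' * h)) x = SH (x' * h) (\<lambda>k l. sH (\<phi> l) (x * k))"
    using left_integralD[OF \<phi> linx, of "x' * h"] by simp
  also have "\<dots> = SH h (\<lambda>p q. sH (\<phi> (x' * q)) (x * (x' * p)))"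
    by (subst SH_mult[OF bil], subst SH_grouplike[OF x' bil']) simp
  finally show ?thesis by (simp add: inv flip: mult.assoc)
qed

context hopf_comodule
begin

lemmas A_simps = algebra_scale_mult[OF algebra_A] vector_space.vector_space_assms[OF vs_A]

definition homogeneous :: "'h \<Rightarrow> 'a set" where
  "homogeneous x = {a. \<alpha> a = tAH a x}"

lemma coinvariants_eq: "coinvariants tAH \<alpha> = homogeneous 1"
  by (simp add: coinvariants_def homogeneous_def)

lemma SA_homogeneous: "a \<in> homogeneous x \<Longrightarrow> bilin sA sH sX \<beta> \<Longrightarrow> SA a \<beta> = \<beta> a x"
  using sweedler_tensor[OF tensor_AH] by (simp add: homogeneous_def)

lemma homogeneous_scale: "a \<in> homogeneous x \<Longrightarrow> sA c a \<in> homogeneous x"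
  using linear_\<alpha> bilin_AH by (simp add: homogeneous_def bilin_iff Vector_Spaces.linear_iff)

lemma homogeneous_mult:
  assumes a: "a \<in> homogeneous x" and b: "b \<in> homogeneous y"
  shows "a * b \<in> homogeneous (x * y)"
proof -
  have 1: "bilin sA sH sAH (\<lambda>c g. tAH (d * c) (h * g))" for d h
    using bilin_AH by (intro bilin_AI vs_AH) (simp_all add: bilin_iff H_simps A_simps)
  have 2: "bilin sA sH sAH (\<lambda>d h. tAH (d * c) (h * g))" for c g
    using bilin_AH by (intro bilin_AI vs_AH) (simp_all add: bilin_iff H_simps A_simps)
  have "\<alpha> (a * b) = SA (a * b) tAH" by (simp add: sweedler_self[OF tensor_AH])
  also have "\<dots> = tAH (a * b) (x * y)"
    by (simp add: SA_mult[OF bilin_AH] SA_homogeneous[OF b 1] SA_homogeneous[OF a 2])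
  finally show ?thesis by (simp add: homogeneous_def)
qed

lemma homogeneous_coinvariant_mult:
  assumes "a \<in> homogeneous x" and "q \<in> homogeneous 1"
  shows "a * q \<in> homogeneous x" "q * a \<in> homogeneous x"
  using homogeneous_mult[of a x q 1] homogeneous_mult[of q 1 a x] assms by simp_all

text \<open>This is \<open>(id \<otimes> f) \<alpha>\<close>. The maps \<open>E\<close> and
  \<open>R\<close> of the outline are the slices along \<phi> and along \<phi> after
  \<open>S\<close>.\<close>

definition slice :: "('h \<Rightarrow> 'k) \<Rightarrow> 'a \<Rightarrow> 'a" where
  "slice f a = SA a (\<lambda>x h. sA (f h) x)"

lemma bilin_slice: "functional f \<Longrightarrow> bilin sA sH sA (\<lambda>x h. sA (f h) x)"
  by (intro bilin_AI vs_A) (simp_all add: A_simps Vector_Spaces.linear_iff mult_ac)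

lemma linear_slice: "functional f \<Longrightarrow> Vector_Spaces.linear sA sA (slice f)"
  unfolding slice_def[abs_def] by (rule linear_SA[OF bilin_slice])

text \<open>Multiplication by a coinvariant only touches the \<open>A\<close>-leg of the coaction,
  so slices are bimodule maps over the coinvariants.\<close>

lemma slice_mult:
  assumes f: "functional f" and p: "p \<in> homogeneous 1"
  shows "slice f (p * b) = p * slice f b" and "slice f (b * p) = slice f b * p"
proof -
  note simps = H_simps A_simps Vector_Spaces.linear_iff mult_ac sweedler_add
  have linl: "Vector_Spaces.linear sA sA (\<lambda>y. p * y)" and linr: "Vector_Spaces.linear sA sA (\<lambda>y. y * p)"
    using vs_A by (simp_all add: Vector_Spaces.linear_iff A_simps H_simps)
  have 1: "bilin sA sH sA (\<lambda>a h. SA b (\<lambda>c g. sA (f (h * g)) (a * c)))"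
    using f by (intro bilin_AI vs_A) (simp_all add: simps sweedler_scale[OF vs_A, symmetric])
  have 2: "bilin sA sH sA (\<lambda>c g. sA (f (h * g)) (a * c))" for a h
    using f by (intro bilin_AI vs_A) (simp_all add: simps)
  show "slice f (p * b) = p * slice f b"
    unfolding slice_def SA_mult[OF bilin_slice[OF f]] SA_homogeneous[OF p 1] linear_sweedler[OF linl]
    by (simp add: A_simps)
  show "slice f (b * p) = slice f b * p"
    unfolding slice_def SA_mult[OF bilin_slice[OF f]] SA_homogeneous[OF p 2] linear_sweedler[OF linr]
    by (simp add: A_simps)
qed

text \<open>By coassociativity the coaction of \<open>slice f a\<close> is
  \<open>a_0 \<otimes> a_1 f(a_2)\<close>, and the hypothesis on \<open>f\<close> replaces
  \<open>a_1 f(a_2)\<close> by \<open>f(a_1) x\<close>.\<close>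

lemma slice_homogeneous:
  assumes f: "functional f" and x: "\<And>h. SH h (\<lambda>k l. sH (f l) k) = sH (f h) x"
  shows "slice f a \<in> homogeneous x"
proof -
  have tri: "trilin sA sH sH sAH (\<lambda>z k l. sAH (f l) (tAH z k))"
    using bilin_AH f vector_space.vector_space_assms[OF vs_AH]
    by (intro trilin_AI vs_AH) (simp_all add: bilin_iff H_simps Vector_Spaces.linear_iff mult_ac)
  have lin1: "Vector_Spaces.linear sA sAH (\<lambda>z. tAH z v)" and lin2: "Vector_Spaces.linear sH sAH (tAH z)" for v z
    using bilin_AH by (simp_all add: bilin_def)
  have "\<alpha> (slice f a) = SA a (\<lambda>y h. SA y (\<lambda>z k. sAH (f h) (tAH z k)))"
    unfolding slice_def linear_sweedler[OF linear_\<alpha>] using linear_\<alpha>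
    by (simp add: Vector_Spaces.linear_iff sweedler_scale[OF vs_AH] sweedler_self[OF tensor_AH])
  also have "\<dots> = SA a (\<lambda>y h. SH h (\<lambda>k l. sAH (f l) (tAH y k)))"
    by (rule coassoc[OF tri])
  also have "\<dots> = SA a (\<lambda>y h. tAH y (SH h (\<lambda>k l. sH (f l) k)))"
    using bilin_AH by (simp add: linear_sweedler[OF lin2] bilin_iff)
  also have "\<dots> = SA a (\<lambda>y h. tAH (sA (f h) y) x)"
    using bilin_AH by (simp add: x bilin_iff)
  also have "\<dots> = tAH (slice f a) x"
    by (simp add: slice_def linear_sweedler[OF lin1])
  finally show ?thesis by (simp add: homogeneous_def)
qed

text \<open>This is \<open>f\<close> applied to \<open>strong_invariance\<close>. For
  \<open>f = \<phi>\<close> it moves \<open>E\<close> to the other factor, where it becomes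
  \<open>R\<close>.\<close>

lemma invariant_slice:
  assumes \<psi>: "invariant \<psi>" and f: "functional f"
  shows "\<psi> (slice f a * b) = \<psi> (a * slice (\<lambda>h. f (S h)) b)"
proof -
  have \<psi>lin: "Vector_Spaces.linear sA (*) \<psi>" using \<psi> by (simp add: invariant_def)
  have l1: "Vector_Spaces.linear sA (*) (\<lambda>x. \<psi> (x * b))" and l2: "Vector_Spaces.linear sA (*) (\<lambda>x. \<psi> (a * x))"
    using \<psi>lin by (simp_all add: Vector_Spaces.linear_iff A_simps H_simps)
  have "\<psi> (slice f a * b) = f (SA a (\<lambda>x h. sH (\<psi> (x * b)) h))"
    unfolding slice_def linear_sweedler[OF l1] linear_sweedler[OF f] using \<psi>lin f
    by (simp add: Vector_Spaces.linear_iff A_simps mult.commute)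
  also have "\<dots> = f (SA b (\<lambda>y h. sH (\<psi> (a * y)) (S h)))"
    by (simp add: strong_invariance[OF \<psi>])
  also have "\<dots> = \<psi> (a * slice (\<lambda>h. f (S h)) b)"
    unfolding slice_def linear_sweedler[OF l2] linear_sweedler[OF f] using \<psi>lin f
    by (simp add: Vector_Spaces.linear_iff A_simps mult.commute)
  finally show ?thesis .
qed

text \<open>Write \<open>c \<otimes> h\<close> as an image under the Galois map and apply
  \<open>id \<otimes> f\<close>, called \<open>L\<close>. The left side becomes \<open>c\<close>
  because \<open>f h = 1\<close>, and the image of \<open>d \<otimes> a\<close> becomes
  \<open>d * slice f a\<close>.\<close>

lemma galois_span:
  assumes T: "is_tensor_product sA sA sAA tAA"
    and surj: "surj (tlift sAA sAH tAA (\<lambda>a b. tmult sAH tAH (tAH a 1) (\<alpha> b)))"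
    and f: "functional f" and h: "f h = 1"
  shows "c \<in> module.span sA {d * slice f a | d a. True}"
proof -
  interpret A: vector_space sA by (rule vs_A)
  define G where "G a b = tmult sAH tAH (tAH a 1) (\<alpha> b)" for a b
  have 1: "bilin sA sH sAH (\<lambda>y k. SA b (\<lambda>z l. tAH (y * z) (k * l)))" for b
    using bilin_AH by (intro bilin_AI vs_AH)
      (simp_all add: bilin_iff A_simps H_simps sweedler_add sweedler_scale[OF vs_AH])
  have 2: "bilin sA sH sAH (\<lambda>z l. tAH (a * z) l)" for a
    using bilin_AH by (intro bilin_AI vs_AH) (simp_all add: bilin_iff A_simps H_simps)
  have G: "G a b = SA b (\<lambda>z l. tAH (a * z) l)" for a b
    unfolding G_def tmult_eq_sweedler[OF tensor_AH algebra_A algebra_H]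
    by (simp add: sweedler_tensor[OF tensor_AH 1])
  have bilG: "bilin sA sA sAH G"
    using linear_SA[OF 2] vs_A vs_AH bilin_AH
    by (simp add: bilin_iff G Vector_Spaces.linear_iff H_simps A_simps sweedler_add sweedler_scale[OF vs_AH])
  define L where "L u = sweedler sH tAH u (\<lambda>y k. sA (f k) y)" for u
  have L: "Vector_Spaces.linear sAH sA L"
    unfolding L_def by (rule linear_sweedler_arg[OF tensor_AH bilin_slice[OF f]])
  have Lt: "L (tAH y k) = sA (f k) y" for y k
    unfolding L_def by (rule sweedler_tensor[OF tensor_AH bilin_slice[OF f]])
  have LG: "L (G a b) = a * slice f b" for a b
  proof -
    have lin: "Vector_Spaces.linear sA sA ((*) a)"
      using vs_A by (simp add: Vector_Spaces.linear_iff A_simps H_simps)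
    show ?thesis unfolding G linear_sweedler[OF L] Lt slice_def linear_sweedler[OF lin]
      by (simp add: A_simps)
  qed
  obtain z where z: "tAH c h = tlift sAA sAH tAA G z"
    using surjD[OF surj] unfolding G_def by blast
  then have "c = L (sweedler sA tAA z G)"
    by (simp add: tlift_eq_sweedler[OF T bilG, symmetric] Lt h flip: z)
  also have "\<dots> = sweedler sA tAA z (\<lambda>d a. d * slice f a)"
    by (simp add: linear_sweedler[OF L] LG)
  also have "\<dots> \<in> A.span {d * slice f a | d a. True}"
    unfolding sweedler_def by (intro A.span_sum A.span_base) auto
  finally show ?thesis .
qed

end

section \<open>Galois objects with a normalised left integral on the Hopf algebra\<close>

locale galois = hopf_comodule sH sHH sHHH tHH tHHH \<Delta> \<epsilon> S sA sAH sAHH tAH tAHH \<alpha>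
  for sH :: "'k::field \<Rightarrow> 'h::ring_1 \<Rightarrow> 'h"
    and sHH :: "'k \<Rightarrow> 'hh::ab_group_add \<Rightarrow> 'hh"
    and sHHH :: "'k \<Rightarrow> 'hhh::ab_group_add \<Rightarrow> 'hhh"
    and tHH :: "'h \<Rightarrow> 'h \<Rightarrow> 'hh" and tHHH :: "'hh \<Rightarrow> 'h \<Rightarrow> 'hhh"
    and \<Delta> :: "'h \<Rightarrow> 'hh" and \<epsilon> :: "'h \<Rightarrow> 'k" and S :: "'h \<Rightarrow> 'h"
    and sA :: "'k \<Rightarrow> 'a::ring \<Rightarrow> 'a"
    and sAH :: "'k \<Rightarrow> 'ah::ab_group_add \<Rightarrow> 'ah"
    and sAHH :: "'k \<Rightarrow> 'ahh::ab_group_add \<Rightarrow> 'ahh"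
    and tAH :: "'a \<Rightarrow> 'h \<Rightarrow> 'ah" and tAHH :: "'ah \<Rightarrow> 'h \<Rightarrow> 'ahh"
    and \<alpha> :: "'a \<Rightarrow> 'ah" +
  fixes sAA :: "'k \<Rightarrow> 'aa::ab_group_add \<Rightarrow> 'aa" and tAA :: "'a \<Rightarrow> 'a \<Rightarrow> 'aa"
    and I :: "'i set" and p :: "'i \<Rightarrow> 'a" and \<phi> :: "'h \<Rightarrow> 'k" and h\<^sub>0 :: 'h
  assumes gal: "galois_object sA sH sHH sAH sAHH sAA tHH tAH tAHH tAA \<Delta> \<epsilon> \<alpha> I p"
    and \<phi>: "left_integral \<phi>" "\<phi> h\<^sub>0 = 1"
begin

sublocale A: vector_space sA by (rule vs_A)

lemma idem: "i \<in> I \<Longrightarrow> p i * p i = p i" and p_nonzero: "i \<in> I \<Longrightarrow> p i \<noteq> 0"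
  and orth: "i \<in> I \<Longrightarrow> j \<in> I \<Longrightarrow> i \<noteq> j \<Longrightarrow> p i * p j = 0"
  and coinv: "homogeneous 1 = A.span (p ` I)"
  using gal unfolding galois_object_def coinvariants_eq by auto

lemma p_coinv: "i \<in> I \<Longrightarrow> p i \<in> homogeneous 1"
  unfolding coinv by (rule A.span_base) auto

lemma functional_translate: "functional (\<lambda>k. \<phi> (x * k))"
  using left_integral_linear[OF \<phi>(1)] by (simp add: Vector_Spaces.linear_iff H_simps)

text \<open>Slices along the translate of \<phi> by \<open>x'\<close> are
  \<open>x\<close>-homogeneous, and this translate takes the value 1 at
  \<open>x * h\<^sub>0\<close>, so \<open>galois_span\<close> applies.\<close>

lemma span_homogeneous:
  assumes "grouplike x'" "x * x' = 1" "x' * x = 1"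
  shows "c \<in> A.span {d * y | d y. y \<in> homogeneous x}"
proof -
  have "c \<in> A.span {d * slice (\<lambda>k. \<phi> (x' * k)) a | d a. True}"
    using gal \<phi>(2) assms unfolding galois_object_def
    by (intro galois_span[where h = "x * h\<^sub>0" and tAA = tAA and sAA = sAA] functional_translate)
      (simp_all add: Let_def flip: mult.assoc)
  moreover have "slice (\<lambda>k. \<phi> (x' * k)) a \<in> homogeneous x" for a
    by (intro slice_homogeneous functional_translate left_integral_translate[OF \<phi>(1) assms(1,2)])
  then have "{d * slice (\<lambda>k. \<phi> (x' * k)) a | d a. True} \<subseteq> {d * y | d y. y \<in> homogeneous x}" by auto
  ultimately show ?thesis using A.span_mono by blast
qed

lemma span_mult_zero:
  assumes c: "c \<in> A.span M" and z: "\<And>m. m \<in> M \<Longrightarrow> m * q = 0"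
  shows "c * q = 0"
proof -
  have "A.subspace {x. x * q = 0}"
    by (auto simp: A.subspace_def distrib_right algebra_scale_mult[OF algebra_A])
  with z have "A.span M \<subseteq> {x. x * q = 0}" by (intro A.span_minimal) auto
  with c show ?thesis by auto
qed

text \<open>If right multiplication by \<open>q\<close> killed all products ending in an
  \<open>x\<close>-homogeneous element, it would kill the whole algebra.\<close>

lemma homogeneous_nonzero:
  assumes x: "grouplike x'" "x * x' = 1" "x' * x = 1" and "c * q \<noteq> 0"
  obtains d y where "y \<in> homogeneous x" "d * y * q \<noteq> 0"
proof -
  have "\<not> (\<forall>m \<in> {d * y | d y. y \<in> homogeneous x}. m * q = 0)"
    using span_mult_zero[OF span_homogeneous[OF x], of q c] assms(4) by blast
  then show thesis using that by auto
qed

text \<open>Expand \<open>b\<close> in the orthogonal idempotents: only the coefficient at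
  \<open>i\<close> survives, and it is the same on either side.\<close>

lemma coinv_mult_p:
  assumes "b \<in> homogeneous 1" and i: "i \<in> I"
  obtains c where "b * p i = sA c (p i)" "p i * b = sA c (p i)"
proof -
  have "\<exists>c. b * p i = sA c (p i) \<and> p i * b = sA c (p i)"
    using assms(1) unfolding coinv
  proof (induction rule: A.span_induct_alt)
    case base
    show ?case by (rule exI[of _ 0]) simp
  next
    case (step k x y)
    obtain j where j: "j \<in> I" "x = p j" using step by auto
    obtain c where c: "y * p i = sA c (p i)" "p i * y = sA c (p i)" using step by auto
    show ?case
      using idem[OF i] orth[OF i j(1)] orth[OF j(1) i] c j
      by (intro exI[of _ "(if j = i then k else 0) + c"])
        (auto simp: distrib_left distrib_right algebra_scale_mult[OF algebra_A] A.scale_left_distrib)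
  qed
  with that show thesis by blast
qed

text \<open>The algebra may lack a unit, but it is spanned by products \<open>d * y\<close> with
  \<open>y\<close> coinvariant, and such a \<open>y\<close> is a finite combination of the
  \<open>p i\<close>.\<close>

lemma right_local_unit: "\<exists>F. finite F \<and> F \<subseteq> I \<and> a * (\<Sum>m\<in>F. p m) = a"
proof -
  \<comment> \<open>Asking for the identity for all larger finite \<open>D\<close> makes
    \<open>Q\<close> closed under addition: two supports can be united.\<close>
  define Q where "Q = {a. \<exists>F. finite F \<and> F \<subseteq> I \<and> (\<forall>D. finite D \<longrightarrow> F \<subseteq> D \<longrightarrow> D \<subseteq> I \<longrightarrow> a * (\<Sum>m\<in>D. p m) = a)}"
  have QI: "a \<in> Q" if "finite F" "F \<subseteq> I" "\<And>D. finite D \<Longrightarrow> F \<subseteq> D \<Longrightarrow> D \<subseteq> I \<Longrightarrow> a * (\<Sum>m\<in>D. p m) = a" for a F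
    using that unfolding Q_def by blast
  have QE: "\<exists>F. finite F \<and> F \<subseteq> I \<and> (\<forall>D. finite D \<longrightarrow> F \<subseteq> D \<longrightarrow> D \<subseteq> I \<longrightarrow> a * (\<Sum>m\<in>D. p m) = a)" if "a \<in> Q" for a
    using that unfolding Q_def by blast
  have sub: "A.subspace Q"
    unfolding A.subspace_def
  proof (intro conjI ballI allI)
    show "0 \<in> Q" by (rule QI[of "{}"]) simp_all
  next
    fix x y assume "x \<in> Q" "y \<in> Q"
    from this[THEN QE] obtain F F' where
      F: "finite F" "F \<subseteq> I" "\<forall>D. finite D \<longrightarrow> F \<subseteq> D \<longrightarrow> D \<subseteq> I \<longrightarrow> x * (\<Sum>m\<in>D. p m) = x"
      and F': "finite F'" "F' \<subseteq> I" "\<forall>D. finite D \<longrightarrow> F' \<subseteq> D \<longrightarrow> D \<subseteq> I \<longrightarrow> y * (\<Sum>m\<in>D. p m) = y"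
      by blast
    show "x + y \<in> Q"
      using F F' by (intro QI[of "F \<union> F'"]) (simp_all add: distrib_right)
  next
    fix c x assume "x \<in> Q"
    from QE[OF this] obtain F where
      F: "finite F" "F \<subseteq> I" "\<forall>D. finite D \<longrightarrow> F \<subseteq> D \<longrightarrow> D \<subseteq> I \<longrightarrow> x * (\<Sum>m\<in>D. p m) = x"
      by blast
    show "sA c x \<in> Q"
      using F by (intro QI[of F]) (simp_all add: algebra_scale_mult[OF algebra_A])
  qed
  have "p i \<in> Q" if i: "i \<in> I" for i
  proof -
    have "p i * (\<Sum>m\<in>F'. p m) = p i" if "finite F'" "i \<in> F'" "F' \<subseteq> I" for F'
    proof -
      have "p i * (\<Sum>m\<in>F'. p m) = (\<Sum>m\<in>F'. if m = i then p i else 0)"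
        unfolding sum_distrib_left by (rule sum.cong) (use i that idem orth in auto)
      with that show ?thesis by simp
    qed
    with i show ?thesis by (intro QI[of "{i}"]) simp_all
  qed
  then have "p ` I \<subseteq> Q" by blast
  from A.span_minimal[OF this sub] have sub1: "homogeneous 1 \<subseteq> Q" by (simp only: coinv)
  have "d * y \<in> Q" if "y \<in> homogeneous 1" for d y
  proof -
    from that sub1 obtain F where
      F: "finite F" "F \<subseteq> I" "\<forall>D. finite D \<longrightarrow> F \<subseteq> D \<longrightarrow> D \<subseteq> I \<longrightarrow> y * (\<Sum>m\<in>D. p m) = y"
      using QE[of y] by (meson subsetD)
    show ?thesis using F by (intro QI[of F]) (simp_all add: mult.assoc)
  qed
  then have "{d * y | d y. y \<in> homogeneous 1} \<subseteq> Q" by blast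
  from A.span_minimal[OF this sub] have "a \<in> Q" using span_homogeneous[OF grouplike_one, of 1 a] by auto
  from QE[OF this] obtain F where
    "finite F" "F \<subseteq> I" "\<forall>D. finite D \<longrightarrow> F \<subseteq> D \<longrightarrow> D \<subseteq> I \<longrightarrow> a * (\<Sum>m\<in>D. p m) = a"
    by blast
  then show ?thesis by (intro exI[of _ F]) simp
qed

text \<open>Insert a local unit after \<open>a\<close> and pick a nonvanishing summand.\<close>

lemma p_between:
  assumes "a * q \<noteq> 0"
  obtains m where "m \<in> I" "a * p m * q \<noteq> 0"
proof -
  obtain F where F: "F \<subseteq> I" "a * (\<Sum>m\<in>F. p m) = a" using right_local_unit by blast
  have "(\<Sum>m\<in>F. a * p m * q) = a * (\<Sum>m\<in>F. p m) * q"
    by (simp add: sum_distrib_left sum_distrib_right)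
  then have "a * q = (\<Sum>m\<in>F. a * p m * q)" using F(2) by simp
  with assms have "(\<Sum>m\<in>F. a * p m * q) \<noteq> 0" by simp
  from sum.not_neutral_contains_not_neutral[OF this] obtain m where "m \<in> F" "a * p m * q \<noteq> 0" .
  with F(1) show thesis by (intro that[of m]) auto
qed

text \<open>The spaces of \<open>x\<close>- and \<open>x\<inverse>\<close>-homogeneous elements are mutually inverse bimodules over the coinvariants.\<close>
lemma homogeneous_pairing:
  assumes x: "grouplike x" "grouplike x'" "x * x' = 1" "x' * x = 1" and l: "l \<in> I"
  obtains m w v where "m \<in> I" "w \<in> homogeneous x" "v \<in> homogeneous x'"
    "p l * w = w" "w * p m = w" "p m * v = v" "v * p l = v" "w * v = p l" "v * w = p m"
proof -
  \<comment> \<open>Spanning by homogeneous elements is used twice, for \<open>x'\<close> and then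
    for \<open>x\<close>, to find a nonzero product \<open>t * p m * y * p l\<close> whose factors
    \<open>t\<close> and \<open>y\<close> have inverse degrees.\<close>
  have "p l * p l \<noteq> 0" using l by (simp add: idem p_nonzero)
  then obtain d y where y: "y \<in> homogeneous x'" "d * y * p l \<noteq> 0"
    using homogeneous_nonzero[OF x(1,4,3)] by metis
  then have "d * (y * p l) \<noteq> 0" by (simp add: mult.assoc)
  then obtain e t where t: "t \<in> homogeneous x" and "e * t * (y * p l) \<noteq> 0"
    using homogeneous_nonzero[OF x(2,3,4)] by metis
  then have "t * (y * p l) \<noteq> 0" by (auto simp: mult.assoc)
  then obtain m where m: "m \<in> I" "t * p m * (y * p l) \<noteq> 0" using p_between by blast
  note pc = p_coinv[OF l] p_coinv[OF m(1)]
  have "t * p m * y \<in> homogeneous 1"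
    using homogeneous_mult[OF homogeneous_coinvariant_mult(1)[OF t pc(2)] y(1)] x(3) by simp
  then obtain c where c: "t * p m * y * p l = sA c (p l)" using coinv_mult_p[OF _ l] by metis
  with m have c0: "c \<noteq> 0" by (auto simp: mult.assoc)
  \<comment> \<open>Dividing by \<open>c\<close> normalises \<open>w * v\<close> to
    \<open>p l\<close>.\<close>
  define w where "w = sA (inverse c) (p l * t * p m)"
  define v where "v = p m * y * p l"
  note simps = algebra_scale_mult[OF algebra_A]
  have idl: "p l * (p l * z) = p l * z" and idm: "p m * (p m * z) = p m * z" for z
    using idem[OF l] idem[OF m(1)] by (metis mult.assoc)+
  have w: "w \<in> homogeneous x" "v \<in> homogeneous x'"
    unfolding w_def v_def
    by (intro homogeneous_scale homogeneous_coinvariant_mult pc t y)+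
  have absorb: "p l * w = w" "w * p m = w" "p m * v = v" "v * p l = v"
    unfolding w_def v_def using idem[OF l] idem[OF m(1)] by (simp_all add: simps idl idm mult.assoc)
  have "w * v = sA (inverse c) (p l * (t * p m * y * p l))"
    unfolding w_def v_def by (simp add: simps idl idm mult.assoc)
  then have wv: "w * v = p l" using c0 by (simp add: c simps idem[OF l])
  have "v * w \<in> homogeneous 1" using homogeneous_mult[OF w(2,1)] x(4) by simp
  then obtain k where "v * w * p m = sA k (p m)" using coinv_mult_p[OF _ m(1)] by metis
  then have k: "v * w = sA k (p m)" using absorb(2) by (simp add: mult.assoc)
  \<comment> \<open>Squaring \<open>w * v = p l\<close> forces \<open>k = 1\<close>.\<close>
  have "p l = w * (v * w) * v" using wv idem[OF l] by (simp add: mult.assoc flip: mult.assoc[of w v])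
  also have "\<dots> = sA k (p l)" unfolding k by (simp add: simps absorb wv)
  finally have "sA (1 - k) (p l) = 0" by (simp add: A.scale_left_diff_distrib)
  then have "k = 1" using p_nonzero[OF l] by simp
  with k have "v * w = p m" by simp
  with that m w absorb wv show thesis by blast
qed

text \<open>In the construction \<open>w i\<close> spans \<open>p i A_g\<close>, \<open>a i\<close>
  satisfies \<open>E(a_i) p_i = p_i\<close>, and \<open>\<kappa> i b\<close> is the coefficient of
  \<open>p_i R(b)\<close> along \<open>w i\<close>. All of this is chosen before \<psi>, so an
  invariant functional enters row \<open>i\<close> only through the scalar
  \<open>\<psi> (a i * w i)\<close>.\<close>

lemma corner_permutation:
  assumes g: "grouplike g" and R: "\<And>h. SH h (\<lambda>k l. sH (\<phi> (S l)) k) = sH (\<phi> (S h)) g"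
  obtains \<mu> w a \<kappa> where "bij_betw \<mu> I I"
    and "\<And>\<psi> i b. invariant \<psi> \<Longrightarrow> i \<in> I \<Longrightarrow> \<psi> (p i * b) = \<kappa> i b * \<psi> (a i * w i)"
    and "\<And>\<psi> i j b. invariant \<psi> \<Longrightarrow> i \<in> I \<Longrightarrow> j \<in> I \<Longrightarrow>
      \<psi> (p i * b * p j) = (if j = \<mu> i then \<kappa> i b * \<psi> (a i * w i) else 0)"
proof -
  note inv = grouplike_inverse[OF g]
  note scale_mult = algebra_scale_mult[OF algebra_A]
  define P where "P l m w v \<longleftrightarrow> m \<in> I \<and> w \<in> homogeneous g \<and> v \<in> homogeneous (S g) \<and>
    p l * w = w \<and> w * p m = w \<and> p m * v = v \<and> v * p l = v \<and> w * v = p l \<and> v * w = p m" for l m w v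
  have "\<exists>m w v. P l m w v" if "l \<in> I" for l
    by (rule homogeneous_pairing[OF g inv(3,1,2) that]) (auto simp: P_def)
  then obtain \<mu> w v where "\<And>l. l \<in> I \<Longrightarrow> P l (\<mu> l) (w l) (v l)"
    by metis
  note \<mu> = this[unfolded P_def]
  have w0: "w l \<noteq> 0" if "l \<in> I" for l
    using \<mu>[OF that] p_nonzero[OF that] by auto
  \<comment> \<open>After multiplication by \<open>p l\<close>, \<open>y\<close> is recovered as
    \<open>w l * (v l * y)\<close>, where \<open>v l * y\<close> is a coinvariant absorbed by
    \<open>p (\<mu> l)\<close> and hence a multiple of it.\<close>
  have one_dim: "\<exists>c. p l * y = sA c (w l)" if l: "l \<in> I" and y: "y \<in> homogeneous g" for l y
  proof -
    have "v l * y \<in> homogeneous 1" using homogeneous_mult[of "v l" "S g" y g] \<mu>[OF l] y inv by simp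
    then obtain c where "p (\<mu> l) * (v l * y) = sA c (p (\<mu> l))"
      using coinv_mult_p \<mu>[OF l] by metis
    then have "v l * y = sA c (p (\<mu> l))" using \<mu>[OF l] by (simp flip: mult.assoc)
    then have "w l * (v l * y) = sA c (w l)" using \<mu>[OF l] by (simp add: scale_mult)
    then show ?thesis using \<mu>[OF l] by (auto simp flip: mult.assoc)
  qed
  have wp: "w l * p m = 0" if "l \<in> I" "m \<in> I" "m \<noteq> \<mu> l" for l m
  proof -
    have "w l * p m = w l * (p (\<mu> l) * p m)" using \<mu>[OF that(1)] by (simp flip: mult.assoc)
    then show ?thesis using orth[of "\<mu> l" m] \<mu>[OF that(1)] that by auto
  qed
  have "bij_betw \<mu> I I"
    unfolding bij_betw_def
  proof
    show "inj_on \<mu> I"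
    proof (rule inj_onI, rule ccontr)
      fix l l' assume l: "l \<in> I" "l' \<in> I" and eq: "\<mu> l = \<mu> l'" and ne: "l \<noteq> l'"
      \<comment> \<open>This coinvariant absorbs \<open>p l\<close> on the left and
        \<open>p l'\<close> on the right, so it vanishes; but right multiplication by
        \<open>w l'\<close> turns it back into \<open>w l\<close>.\<close>
      have "w l * v l' \<in> homogeneous 1"
        using homogeneous_mult[of "w l" g "v l'" "S g"] \<mu>[OF l(1)] \<mu>[OF l(2)] inv by simp
      then obtain c where "p l * (w l * v l') = sA c (p l)"
        using coinv_mult_p[OF _ l(1)] by metis
      then have c: "w l * v l' = sA c (p l)" using \<mu>[OF l(1)] by (simp flip: mult.assoc)
      have "w l * v l' = w l * v l' * p l'" using \<mu>[OF l(2)] by (simp add: mult.assoc)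
      also have "\<dots> = 0" unfolding c using orth[OF l ne] by (simp add: scale_mult)
      finally have "w l * v l' * w l' = 0" by simp
      then have "w l * p (\<mu> l') = 0" using \<mu>[OF l(2)] by (simp add: mult.assoc)
      then show False using \<mu>[OF l(1)] eq w0[OF l(1)] by simp
    qed
    show "\<mu> ` I = I"
    proof
      show "\<mu> ` I \<subseteq> I" using \<mu> by auto
      show "I \<subseteq> \<mu> ` I"
      proof
        fix m assume m: "m \<in> I"
        \<comment> \<open>The pairing for \<open>S g\<close> in place of \<open>g\<close> yields a
          \<open>g\<close>-homogeneous \<open>u\<close> whose right idempotent is the prescribed
          \<open>p m\<close>; as a nonzero multiple of \<open>w l\<close> it forces
          \<open>m = \<mu> l\<close>.\<close>
        obtain l z u where l: "l \<in> I" "u \<in> homogeneous g" "p l * u = u" "u * p m = u" and "z * u = p m"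
          by (rule homogeneous_pairing[OF inv(3) g inv(2,1) m])
        then have "u \<noteq> 0" using p_nonzero[OF m] by auto
        obtain c where c: "u = sA c (w l)" using one_dim[OF l(1,2)] l(3) by auto
        have "w l * p m \<noteq> 0" using l(4) \<open>u \<noteq> 0\<close> unfolding c by (auto simp: scale_mult)
        then have "m = \<mu> l" using wp[OF l(1) m] by blast
        then show "m \<in> \<mu> ` I" using l by blast
      qed
    qed
  qed
  note lin = left_integral_linear[OF \<phi>(1)]
  have linS: "functional (\<lambda>h. \<phi> (S h))"
    using lin by (simp add: Vector_Spaces.linear_iff H_simps)
  \<comment> \<open>By \<open>galois_span\<close> some coinvariant \<open>E(a)\<close> is not killed
    by \<open>p i\<close>; its product with \<open>p i\<close> is a nonzero multiple of
    \<open>p i\<close>, and \<open>a\<close> is rescaled.\<close>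
  have "\<exists>a. slice \<phi> a * p i = p i" if i: "i \<in> I" for i
  proof -
    have coinvs: "slice \<phi> a \<in> homogeneous 1" for a
      using slice_homogeneous[OF lin] \<phi>(1) unfolding left_integral_def by blast
    have "p i \<in> A.span {d * slice \<phi> a | d a. True}"
      using gal unfolding galois_object_def
      by (intro galois_span[where h = h\<^sub>0 and tAA = tAA and sAA = sAA] lin \<phi>(2)) (simp_all add: Let_def)
    moreover have "p i * p i \<noteq> 0" using i by (simp add: idem p_nonzero)
    ultimately have "\<not> (\<forall>m \<in> {d * slice \<phi> a | d a. True}. m * p i = 0)"
      using span_mult_zero[of "p i" _ "p i"] by blast
    then obtain d a where "d * slice \<phi> a * p i \<noteq> 0" by auto
    then have nz: "slice \<phi> a * p i \<noteq> 0" by (auto simp: mult.assoc)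
    obtain c where c: "slice \<phi> a * p i = sA c (p i)" using coinv_mult_p[OF coinvs i] by metis
    with nz have "c \<noteq> 0" by auto
    then have "slice \<phi> (sA (inverse c) a) * p i = p i"
      using linear_slice[OF lin] c by (simp add: Vector_Spaces.linear_iff scale_mult)
    then show ?thesis by blast
  qed
  then obtain a where a: "\<And>i. i \<in> I \<Longrightarrow> slice \<phi> (a i) * p i = p i" by metis
  \<comment> \<open>Here \<open>R(b)\<close> lies in \<open>A_g\<close>, so one-dimensionality of
    \<open>p i A_g\<close> provides the coefficient.\<close>
  have "\<forall>i b. \<exists>c. i \<in> I \<longrightarrow> p i * slice (\<lambda>h. \<phi> (S h)) b = sA c (w i)"
    using one_dim slice_homogeneous[OF linS R] by blast
  then obtain \<kappa> where \<kappa>: "\<And>i b. i \<in> I \<Longrightarrow> p i * slice (\<lambda>h. \<phi> (S h)) b = sA (\<kappa> i b) (w i)"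
    by metis
  \<comment> \<open>Insert \<open>E(a_i)\<close> before \<open>p i\<close>, move it across as
    \<open>R\<close>, and pull \<open>p i\<close> out of the slice.\<close>
  have key: "\<psi> (p i * b) = \<psi> (a i * (p i * slice (\<lambda>h. \<phi> (S h)) b))" if "invariant \<psi>" "i \<in> I" for \<psi> i b
  proof -
    have "\<psi> (p i * b) = \<psi> (slice \<phi> (a i) * (p i * b))"
      by (simp add: a[OF that(2)] flip: mult.assoc)
    also have "\<dots> = \<psi> (a i * slice (\<lambda>h. \<phi> (S h)) (p i * b))"
      by (rule invariant_slice[OF that(1) lin])
    finally show ?thesis by (simp add: slice_mult(1)[OF linS p_coinv[OF that(2)]])
  qed
  have lin\<psi>: "\<psi> (a i * sA c x) = c * \<psi> (a i * x)" if "invariant \<psi>" for \<psi> i c x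
    using that by (simp add: invariant_def Vector_Spaces.linear_iff scale_mult)
  have "\<psi> (p i * b) = \<kappa> i b * \<psi> (a i * w i)" if "invariant \<psi>" "i \<in> I" for \<psi> i b
    by (simp add: key[OF that] \<kappa>[OF that(2)] lin\<psi>[OF that(1)])
  moreover have "\<psi> (p i * b * p j) = (if j = \<mu> i then \<kappa> i b * \<psi> (a i * w i) else 0)"
    if \<psi>: "invariant \<psi>" and i: "i \<in> I" and j: "j \<in> I" for \<psi> i j b
  proof -
    have "\<psi> (p i * b * p j) = \<psi> (a i * (p i * slice (\<lambda>h. \<phi> (S h)) b * p j))"
      using key[OF \<psi> i, of "b * p j"] by (simp add: slice_mult(2)[OF linS p_coinv[OF j]] mult.assoc)
    also have "\<dots> = \<kappa> i b * \<psi> (a i * (w i * p j))"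
      by (simp add: \<kappa>[OF i] scale_mult lin\<psi>[OF \<psi>, unfolded scale_mult])
    also have "\<dots> = (if j = \<mu> i then \<kappa> i b * \<psi> (a i * w i) else 0)"
    proof (cases "j = \<mu> i")
      case False
      have "\<psi> 0 = 0" using \<psi> linear_zero_eq[of sA "(*)" \<psi>] by (simp add: invariant_def)
      with False show ?thesis using wp[OF i j] by simp
    qed (use \<mu>[OF i] in simp)
    finally show ?thesis .
  qed
  ultimately show thesis using that \<open>bij_betw \<mu> I I\<close> by blast
qed

end

theorem mainTheorem18:
  fixes sA :: "'k::field \<Rightarrow> 'a::ring \<Rightarrow> 'a"
    and sH :: "'k \<Rightarrow> 'h::ring_1 \<Rightarrow> 'h"
    and sHH :: "'k \<Rightarrow> 'hh::ab_group_add \<Rightarrow> 'hh"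
    and sHHH :: "'k \<Rightarrow> 'hhh::ab_group_add \<Rightarrow> 'hhh"
    and sAH :: "'k \<Rightarrow> 'ah::ab_group_add \<Rightarrow> 'ah"
    and sAHH :: "'k \<Rightarrow> 'ahh::ab_group_add \<Rightarrow> 'ahh"
    and sAA :: "'k \<Rightarrow> 'aa::ab_group_add \<Rightarrow> 'aa"
    and tHH :: "'h \<Rightarrow> 'h \<Rightarrow> 'hh" and tHHH :: "'hh \<Rightarrow> 'h \<Rightarrow> 'hhh"
    and tAH :: "'a \<Rightarrow> 'h \<Rightarrow> 'ah" and tAHH :: "'ah \<Rightarrow> 'h \<Rightarrow> 'ahh"
    and tAA :: "'a \<Rightarrow> 'a \<Rightarrow> 'aa"
    and \<Delta> :: "'h \<Rightarrow> 'hh" and \<epsilon> :: "'h \<Rightarrow> 'k" and S :: "'h \<Rightarrow> 'h"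
    and \<alpha> :: "'a \<Rightarrow> 'ah"
    and I :: "'i set" and p :: "'i \<Rightarrow> 'a"
    and \<psi>A :: "'a \<Rightarrow> 'k"
  assumes "hopf_algebra sH sHH sHHH tHH tHHH \<Delta> \<epsilon> S"
    and "has_invariant_functionals sH sHH tHH \<Delta>"
    and "galois_object sA sH sHH sAH sAHH sAA tHH tAH tAHH tAA \<Delta> \<epsilon> \<alpha> I p"
    and "invariant_functional sA sH sAH tAH \<alpha> \<psi>A"
    and "left_complete I p \<psi>A"
  shows "\<exists>\<mu>. bij_betw \<mu> I I \<and>
           (\<forall>i\<in>I. \<forall>j\<in>I. corner p \<psi>A i j \<noteq> (\<lambda>_. 0) \<longleftrightarrow> j = \<mu> i) \<and>
           (\<forall>\<psi>'. invariant_functional sA sH sAH tAH \<alpha> \<psi>' \<longrightarrow>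
              (\<exists>c :: 'i \<Rightarrow> 'k. \<forall>i\<in>I. \<forall>j\<in>I. \<forall>a.
                 corner p \<psi>' i j a = (if j = \<mu> i then 1 else 0) * c i * corner p \<psi>A i j a))"
proof -
  interpret hopf sH sHH sHHH tHH tHHH \<Delta> \<epsilon> S
    using assms(1) by unfold_locales
  obtain \<phi> \<psi> h\<^sub>0 h\<^sub>1 where \<phi>: "left_integral \<phi>" "\<phi> h\<^sub>0 = 1" and \<psi>: "right_integral \<psi>" "\<psi> h\<^sub>1 = 1"
    using invariant_functionals_integrals[OF assms(2)] by metis
  interpret galois sH sHH sHHH tHH tHHH \<Delta> \<epsilon> S sA sAH sAHH tAH tAHH \<alpha> sAA tAA I p \<phi> h\<^sub>0
  proof unfold_locales
    show "comodule_algebra sA sH sHH sAH sAHH tHH tAH tAHH \<Delta> \<epsilon> \<alpha>"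
      using assms(3) unfolding galois_object_def by blast
  qed (fact assms(3) \<phi>)+
  obtain g where "grouplike g" "\<And>h. SH h (\<lambda>k l. sH (\<phi> (S l)) k) = sH (\<phi> (S h)) g"
    using modular_grouplike_antipode[OF \<phi>(1) _ \<psi>, of h\<^sub>0] \<phi>(2) by auto
  then show ?thesis
  proof (rule corner_permutation)
    fix \<mu> w a \<kappa>
    assume \<mu>: "bij_betw \<mu> I I"
      and row: "\<And>\<psi> i b. invariant \<psi> \<Longrightarrow> i \<in> I \<Longrightarrow> \<psi> (p i * b) = \<kappa> i b * \<psi> (a i * w i)"
      and cor: "\<And>\<psi> i j b. invariant \<psi> \<Longrightarrow> i \<in> I \<Longrightarrow> j \<in> I \<Longrightarrow>
        \<psi> (p i * b * p j) = (if j = \<mu> i then \<kappa> i b * \<psi> (a i * w i) else 0)"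
    have \<psi>A: "invariant \<psi>A" using assms(4) by (simp add: invariant_iff)
    \<comment> \<open>Left completeness makes \<open>\<kappa> i b * \<psi>A (a i * w i)\<close>
      nonzero for some \<open>b\<close>, hence both factors.\<close>
    have nz: "\<psi>A (a i * w i) \<noteq> 0" "\<exists>b. \<kappa> i b \<noteq> 0" if "i \<in> I" for i
      using assms(5) row[OF \<psi>A that] that unfolding left_complete_def by force+
    show ?thesis
    proof (intro exI[of _ \<mu>] conjI ballI allI impI)
      fix i j assume "i \<in> I" "j \<in> I"
      then show "(corner p \<psi>A i j \<noteq> (\<lambda>_. 0)) = (j = \<mu> i)"
        using nz[of i] by (auto simp: corner_def cor[OF \<psi>A] fun_eq_iff)
    next
      fix \<psi>' assume "invariant_functional sA sH sAH tAH \<alpha> \<psi>'"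
      then have \<psi>': "invariant \<psi>'" by (simp add: invariant_iff)
      \<comment> \<open>The scalar is the ratio of the two values at \<open>a i * w i\<close>; the
        coefficients \<open>\<kappa> i\<close> are shared by both functionals.\<close>
      show "\<exists>c. \<forall>i\<in>I. \<forall>j\<in>I. \<forall>a. corner p \<psi>' i j a =
          (if j = \<mu> i then 1 else 0) * c i * corner p \<psi>A i j a"
        using nz by (intro exI[of _ "\<lambda>i. \<psi>' (a i * w i) / \<psi>A (a i * w i)"])
          (simp add: corner_def cor[OF \<psi>A] cor[OF \<psi>'])
    qed (fact \<mu>)
  qed
qed

end
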